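(* Let $q$ be a prime power and $N$ a positive integer. If there exists an $\mathrm{LS}_q[N](2,3,6)$, then there exists an $\mathrm{LS}_q[N](2,k,v)$ for all integers $v$ and $k$ with $v\geq 6$, $v\equiv 2\pmod 4$, $3\leq k\leq v-3$ and $k\equiv 3\pmod 4$.
   Context: Let $V$ be a $v$-dimensional vector space over $\mathrm{GF}(q)$. A $t$-$(v,k,\lambda)_q$ subspace design is a pair $(V,\mathcal{B})$ where $\mathcal{B}$ is a set of $k$-dimensional subspaces of $V$ such that every $t$-dimensional subspace of $V$ is contained in exactly $\lambda$ elements of $\mathcal{B}$. A large set $\mathrm{LS}_q[N](t,k,v)$ is a collection $\{(V,\mathcal{B}_1),\dots,(V,\mathcal{B}_N)\}$ of $t$-$(v,k,\lambda)_q$ subspace designs (same $\lambda$) such that $\{\mathcal{B}_1,\dots,\mathcal{B}_N\}$ is a partition of the set of all $k$-dimensional subspaces of $V$. *)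

theory Defs
  imports "HOL-Library.Cardinality" "HOL-Library.Disjoint_Sets" "HOL-Library.Function_Algebras"
    "HOL-Number_Theory.Prime_Powers" "HOL-Number_Theory.Cong"
begin

locale finite_field_vector_space = vector_space scale
  for scale :: "'a::{field,finite} \<Rightarrow> 'b::ab_group_add \<Rightarrow> 'b"
begin

text \<open>
  The function \<^const>\<open>dim\<close> returns 0 on spaces without a finite basis, so finite dimensionality
  is required separately; over a finite field it amounts to finiteness of the set of vectors.
\<close>

definition space_of_dim :: "'b set \<Rightarrow> nat \<Rightarrow> bool" where
  "space_of_dim V v \<longleftrightarrow> subspace V \<and> finite V \<and> dim V = v"

definition subspaces_of_dim :: "'b set \<Rightarrow> nat \<Rightarrow> 'b set set" where
  "subspaces_of_dim V k = {U. U \<subseteq> V \<and> space_of_dim U k}"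

text \<open>\<open>\<B>\<close> is the block set of a \<open>t\<close>-\<open>(v,k,l)\<^sub>q\<close> subspace design on \<open>V\<close>, where \<open>q = CARD('a)\<close>.\<close>

definition subspace_design ::
    "nat \<Rightarrow> nat \<Rightarrow> nat \<Rightarrow> nat \<Rightarrow> 'b set \<Rightarrow> 'b set set \<Rightarrow> bool" where
  "subspace_design t v k l V \<B> \<longleftrightarrow>
     space_of_dim V v \<and> \<B> \<subseteq> subspaces_of_dim V k \<and>
     (\<forall>T\<in>subspaces_of_dim V t. card {K\<in>\<B>. T \<subseteq> K} = l)"

text \<open>
  \<open>P = {\<B>\<^sub>1, \<dots>, \<B>\<^sub>N}\<close> is the collection of block sets of a large set \<open>LS\<^sub>q[N](t,k,v)\<close> on \<open>V\<close>.
\<close>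

definition large_set ::
    "nat \<Rightarrow> nat \<Rightarrow> nat \<Rightarrow> nat \<Rightarrow> 'b set \<Rightarrow> 'b set set set \<Rightarrow> bool" where
  "large_set N t k v V P \<longleftrightarrow>
     space_of_dim V v \<and> finite P \<and> card P = N \<and>
     partition_on (subspaces_of_dim V k) P \<and>
     (\<exists>l. \<forall>\<B>\<in>P. subspace_design t v k l V \<B>)"

end

text \<open>
  Existence of a \<open>v\<close>-dimensional space carrying a large set cannot quantify over the type of
  vectors. The functions \<open>nat \<Rightarrow> 'a\<close> with pointwise operations serve as universe: every
  finite-dimensional space over \<open>'a\<close> is isomorphic to a subspace of it, and having a large set is
  invariant under isomorphism.
\<close>

definition fun_scale :: "'a::field \<Rightarrow> (nat \<Rightarrow> 'a) \<Rightarrow> nat \<Rightarrow> 'a" where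
  "fun_scale c f = (\<lambda>i. c * f i)"

interpretation fun_space: finite_field_vector_space
    "fun_scale :: 'a::{field,finite} \<Rightarrow> (nat \<Rightarrow> 'a) \<Rightarrow> nat \<Rightarrow> 'a"
  by unfold_locales (auto simp: fun_scale_def plus_fun_def algebra_simps)

definition LS_exists :: "'a::{field,finite} itself \<Rightarrow> nat \<Rightarrow> nat \<Rightarrow> nat \<Rightarrow> nat \<Rightarrow> bool" where
  "LS_exists _ N t k v \<longleftrightarrow> (\<exists>(V :: (nat \<Rightarrow> 'a) set) P. fun_space.large_set N t k v V P)"

end

theory Submission imports Defs "HOL-Library.Set_Algebras" begin

text \<open>
  Fix a subspace \<open>X\<close> of \<open>V\<close>. Given \<open>K\<^sub>1 \<subseteq> X\<close>, \<open>K\<^sub>2 \<supseteq> X\<close> and \<open>T\<close> with \<open>T \<inter> X \<subseteq> K\<^sub>1\<close> and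
  \<open>T + X \<subseteq> K\<^sub>2\<close>, the number of subspaces \<open>K \<supseteq> T\<close> with \<open>K \<inter> X = K\<^sub>1\<close> and \<open>K + X = K\<^sub>2\<close> depends only on
  dimensions. Hence, if the admissible \<open>K\<^sub>1\<close> and \<open>K\<^sub>2\<close> are coloured by \<open>\<int>/N\<close> such that the colour classes
  are designs of strengths \<open>t\<^sub>1\<close> and \<open>t\<^sub>2\<close>, adding the colours of \<open>K \<inter> X\<close> and \<open>K + X\<close> gives colour classes
  of strength \<open>t\<^sub>1 + t\<^sub>2 + 1\<close>: of the two colourings, one is always balanced for the given \<open>T\<close>.

  Along a full flag \<open>F\<close>, the \<open>k\<close>-subspaces \<open>K\<close> split into such joins in two ways: by the unique \<open>j\<close> where
  \<open>dim (K \<inter> F j)\<close> steps from \<open>a\<close> to \<open>a + 1\<close>, or by the unique \<open>j\<close> where \<open>j - dim (K \<inter> F j)\<close> does.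
  For \<open>a = 3\<close>, every part that occurs is a derived or residual of a smaller large set with \<open>k\<close> and \<open>v - k\<close>
  congruent to 3 modulo 4, and the strengths add up to 2; two inductions starting from \<open>k = v - k = 3\<close>
  therefore reach all the required parameters.
\<close>

section \<open>Sums of colours modulo \<open>N\<close>, and integer sequences with unit
  steps\<close>

text \<open>For fixed \<open>c\<close>, adding \<open>g c\<close> modulo \<open>N\<close> permutes
  the colours, so exactly one value of \<open>f a\<close> produces the sum \<open>m\<close>.
  Uniformity of one colouring is enough, whatever the other does; this is what makes strengths add
  up in \<open>partitionable_join\<close>.\<close>

lemma card_pairs_sum_mod:
  fixes f :: "'a \<Rightarrow> nat" and g :: "'b \<Rightarrow> nat"
  assumes "finite A" "finite C" "\<And>a. a \<in> A \<Longrightarrow> f a < N" "\<And>c. c \<in> C \<Longrightarrow> g c < N"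
    and l: "\<And>i. i < N \<Longrightarrow> card {a\<in>A. f a = i} = l" and m: "m < N"
  shows "card {p \<in> A \<times> C. (f (fst p) + g (snd p)) mod N = m} = l * card C"
proof -
  have fib: "card {a\<in>A. (f a + g c) mod N = m} = l" if c: "c \<in> C" for c
  proof -
    \<comment> \<open>\<open>j\<close> is the representative of \<open>m - g c\<close> modulo
      \<open>N\<close> in the range below \<open>N\<close>.\<close>
    define j where "j = (if g c \<le> m then m - g c else m + N - g c)"
    have "j < N" using m assms(4)[OF c] by (auto simp: j_def)
    moreover have "(f a + g c) mod N = m \<longleftrightarrow> f a = j" if "a \<in> A" for a
      using assms(3)[OF that] assms(4)[OF c] m
      by (auto simp: j_def mod_if le_mod_geq not_less)
    then have "{a\<in>A. (f a + g c) mod N = m} = {a\<in>A. f a = j}" by blast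
    ultimately show ?thesis using l by simp
  qed
  have "{p \<in> A \<times> C. (f (fst p) + g (snd p)) mod N = m}
      = (\<Union>c\<in>C. (\<lambda>a. (a, c)) ` {a\<in>A. (f a + g c) mod N = m})" by force
  moreover have "card (\<Union>c\<in>C. (\<lambda>a. (a, c)) ` {a\<in>A. (f a + g c) mod N = m})
      = (\<Sum>c\<in>C. card ((\<lambda>a. (a, c)) ` {a\<in>A. (f a + g c) mod N = m}))"
    using assms(1,2) by (intro card_UN_disjoint) auto
  moreover have "card ((\<lambda>a. (a, c)) ` {a\<in>A. (f a + g c) mod N = m}) = l" if "c \<in> C" for c
    using fib[OF that] by (simp add: card_image inj_on_def)
  ultimately show ?thesis by simp
qed

text \<open>A discrete intermediate value argument. The position of the step from \<open>a\<close>
  to \<open>Suc a\<close> is written as \<open>a + i\<close>, because \<open>g j \<le> j\<close>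
  excludes earlier positions; the bound \<open>i \<le> v - g v\<close> holds because the remaining
  \<open>g v - Suc a\<close> unit steps must still fit before \<open>v\<close>.\<close>

lemma unit_step_crossing:
  fixes g :: "nat \<Rightarrow> nat"
  assumes step: "\<And>j. j < v \<Longrightarrow> g j \<le> g (Suc j) \<and> g (Suc j) \<le> Suc (g j)"
    and g: "g 0 = 0" "a < g v"
  shows "\<exists>!i. i \<le> v - g v \<and> g (a + i) = a \<and> g (Suc (a + i)) = Suc a"
proof -
  have bd: "g j \<le> g j' \<and> g j' \<le> g j + (j' - j)" if "j \<le> j'" "j' \<le> v" for j j'
    using that
  proof (induction j' rule: dec_induct)
    case (step n)
    then show ?case using assms(1)[of n] by (simp add: Suc_diff_le)
  qed simp
  define J where "J = (LEAST j. a < g j)"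
  have J: "a < g J" unfolding J_def using g(2) by (rule LeastI)
  have Jv: "J \<le> v" unfolding J_def using g(2) by (rule Least_le)
  have "J \<noteq> 0" using J g(1) by (intro notI) simp
  then obtain j where j: "J = Suc j" by (cases J) auto
  have "\<not> a < g j" using not_less_Least[of j "\<lambda>j. a < g j"] j by (simp add: J_def)
  then have gj: "g j = a" "g (Suc j) = Suc a" using step[of j] J Jv j by auto
  have "a \<le> j" using bd[of 0 j] g(1) gj(1) Jv j by simp
  moreover have "g v \<le> Suc a + (v - Suc j)" using bd[of "Suc j" v] gj(2) Jv j by simp
  ultimately have "j - a \<le> v - g v" using Jv j g(2) by linarith
  show ?thesis
  proof (rule ex1I[of _ "j - a"])
    show "j - a \<le> v - g v \<and> g (a + (j - a)) = a \<and> g (Suc (a + (j - a))) = Suc a"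
      using \<open>j - a \<le> v - g v\<close> \<open>a \<le> j\<close> gj by simp
    fix i assume i: "i \<le> v - g v \<and> g (a + i) = a \<and> g (Suc (a + i)) = Suc a"
    \<comment> \<open>This makes the subtraction \<open>v - g v\<close> exact, so an admissible
      \<open>i\<close> keeps \<open>a + i\<close> strictly below \<open>v\<close>.\<close>
    have "g v \<le> v" using bd[of 0 v] g(1) by simp
    then have "Suc (a + i) \<le> v" using i g(2) by linarith
    have "\<not> a + i < j" using bd[of "Suc (a + i)" j] i gj Jv j by auto
    moreover have "\<not> j < a + i" using bd[of "Suc j" "a + i"] i gj \<open>Suc (a + i) \<le> v\<close> by auto
    ultimately show "i = j - a" by simp
  qed
qed

context finite_field_vector_space
begin

subsection \<open>Subspaces of a vector space over a finite field\<close>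

lemma q_gt_1: "1 < CARD('a)"
proof -
  have "card {0, 1 :: 'a} \<le> CARD('a)" by (rule card_mono) auto
  then show ?thesis by simp
qed

lemma subspace_set_plus: "subspace S \<Longrightarrow> subspace T \<Longrightarrow> subspace (S + T)"
  using subspace_sums[of S T] by (simp add: set_plus_def) (smt (verit) Collect_cong)

lemma sums_upper1: "subspace T \<Longrightarrow> S \<subseteq> S + T"
  unfolding set_plus_def using subspace_0 by force

lemma sums_upper2: "subspace S \<Longrightarrow> T \<subseteq> S + T"
  unfolding set_plus_def using subspace_0 by force

lemma sums_least: "subspace U \<Longrightarrow> S \<subseteq> U \<Longrightarrow> T \<subseteq> U \<Longrightarrow> S + T \<subseteq> U"
  unfolding set_plus_def using subspace_add by blast

lemma sums_mono: "S \<subseteq> S' \<Longrightarrow> T \<subseteq> T' \<Longrightarrow> S + T \<subseteq> S' + T'"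
  unfolding set_plus_def by blast

lemma sums_absorb: "subspace S \<Longrightarrow> subspace T \<Longrightarrow> T \<subseteq> S \<Longrightarrow> S + T = S"
  by (meson sums_least sums_upper1 subset_antisym subset_refl)

lemma modular_law:
  assumes "subspace S" "subspace U" "S \<subseteq> U"
  shows "(S + T) \<inter> U = S + (T \<inter> U)"
proof
  show "(S + T) \<inter> U \<subseteq> S + (T \<inter> U)"
  proof
    fix z assume "z \<in> (S + T) \<inter> U"
    then obtain x y where z: "z = x + y" "x \<in> S" "y \<in> T" "z \<in> U" by (auto simp: set_plus_def)
    then have "z - x \<in> U" using assms subspace_diff by blast
    then show "z \<in> S + (T \<inter> U)" using z by (auto simp: set_plus_def)
  qed
qed (use assms in \<open>auto simp: set_plus_def intro: subspace_add\<close>)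

text \<open>Addition maps \<open>S \<times> T\<close> onto \<open>S + T\<close>, and every fibre is
  a translate of the antidiagonal copy \<open>(w, - w)\<close> of
  \<open>S \<inter> T\<close>.\<close>

lemma card_sums_Int:
  assumes "subspace S" "subspace T" "finite S" "finite T"
  shows "card (S + T) * card (S \<inter> T) = card S * card T"
proof -
  have fib: "card {p \<in> S \<times> T. fst p + snd p = z} = card (S \<inter> T)" if zST: "z \<in> S + T" for z
  proof -
    obtain x y where z: "z = x + y" "x \<in> S" "y \<in> T" using zST by (blast elim: set_plus_elim)
    have "{p \<in> S \<times> T. fst p + snd p = z} = (\<lambda>w. (x + w, y - w)) ` (S \<inter> T)"
    proof (intro equalityI subsetI)
      fix p assume "p \<in> {p \<in> S \<times> T. fst p + snd p = z}"
      then have p: "fst p \<in> S" "snd p \<in> T" "fst p + snd p = x + y" using z by auto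
      have "fst p - x \<in> S" "y - snd p \<in> T" using p z assms subspace_diff by blast+
      moreover have e: "fst p - x = y - snd p" using p by (simp add: algebra_simps)
      ultimately have "fst p - x \<in> S \<inter> T" by auto
      moreover have "p = (x + (fst p - x), y - (fst p - x))"
        by (metis e add.commute diff_add_cancel diff_diff_eq2 add_diff_cancel_left' surjective_pairing)
      ultimately show "p \<in> (\<lambda>w. (x + w, y - w)) ` (S \<inter> T)" by blast
    next
      fix p assume "p \<in> (\<lambda>w. (x + w, y - w)) ` (S \<inter> T)"
      then show "p \<in> {p \<in> S \<times> T. fst p + snd p = z}"
        using z assms by (auto intro: subspace_add subspace_diff)
    qed
    moreover have "inj_on (\<lambda>w. (x + w, y - w)) (S \<inter> T)" by (auto intro: inj_onI)
    ultimately show ?thesis by (simp add: card_image)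
  qed
  have "S \<times> T = (\<Union>z\<in>S + T. {p \<in> S \<times> T. fst p + snd p = z})"
    using set_plus_intro by fastforce
  then have "card (S \<times> T) = card (\<Union>z\<in>S + T. {p \<in> S \<times> T. fst p + snd p = z})" by simp
  also have "\<dots> = (\<Sum>z\<in>S + T. card {p \<in> S \<times> T. fst p + snd p = z})"
    by (rule card_UN_disjoint) (use assms finite_set_plus in auto)
  also have "\<dots> = card (S + T) * card (S \<inter> T)" using fib by simp
  finally show ?thesis by (simp add: card_cartesian_product)
qed

lemma card_span_insert:
  assumes "subspace S" "finite S" "x \<notin> S"
  shows "finite (span (insert x S)) \<and> card (span (insert x S)) = CARD('a) * card S"
proof -
  have sp: "span S = S" using assms by simp
  have "span (insert x S) = (\<lambda>(c, y). scale c x + y) ` (UNIV \<times> S)"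
    unfolding span_insert sp
    by (auto simp: image_iff) (metis add.commute diff_add_cancel, metis add_diff_cancel_left')
  moreover have "inj_on (\<lambda>(c, y). scale c x + y) (UNIV \<times> S)"
  proof (intro inj_onI, clarify)
    fix c y d z assume h: "y \<in> S" "z \<in> S" "scale c x + y = scale d x + z"
    then have "scale (c - d) x = z - y" by (simp add: scale_left_diff_distrib algebra_simps)
    then have "scale (c - d) x \<in> S" using h assms(1) subspace_diff by metis
    have "c = d"
    proof (rule ccontr)
      assume "c \<noteq> d"
      then have "x = scale (inverse (c - d)) (scale (c - d) x)" by simp
      then show False using \<open>scale (c - d) x \<in> S\<close> assms subspace_scale by metis
    qed
    then show "c = d \<and> y = z" using h by simp
  qed
  ultimately show ?thesis using assms by (simp add: card_image card_cartesian_product)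
qed

text \<open>Together with \<open>pow_q_eq_iff\<close> this turns identities between cardinalities
  into identities between dimensions; the dimension formula and the dimensions of preimages below
  are obtained by counting in this way.\<close>

lemma card_subspace:
  assumes "subspace S" "finite S"
  shows "card S = CARD('a) ^ dim S"
proof -
  obtain B where B: "B \<subseteq> S" "independent B" "S \<subseteq> span B" "card B = dim S"
    using basis_exists by blast
  have fin: "finite B" using B assms finite_subset by blast
  have "finite (span C) \<and> card (span C) = CARD('a) ^ card C" if "finite C" "independent C" for C
    using that
  proof (induction C)
    case empty then show ?case by simp
  next
    case (insert x C)
    then have "independent C" "x \<notin> span C" by (auto simp: independent_insert)
    then show ?case using insert card_span_insert[of "span C" x]
      by (simp add: subspace_span span_insert span_span)
  qed
  moreover have "span B = S" using B assms by (simp add: span_minimal subset_antisym)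
  ultimately show ?thesis using B fin by auto
qed

lemma pow_q_eq_iff: "CARD('a) ^ m = CARD('a) ^ n \<longleftrightarrow> m = n"
  using q_gt_1 by (simp add: power_inject_exp)

lemma dim_zero: "dim {0} = 0"
proof -
  have "CARD('a) ^ dim {0} = CARD('a) ^ 0" using card_subspace[OF subspace_single_0] by simp
  then show ?thesis by (simp only: pow_q_eq_iff)
qed

lemma dim_mono_fin:
  assumes "subspace S" "subspace T" "finite T" "S \<subseteq> T"
  shows "dim S \<le> dim T"
proof -
  have "CARD('a) ^ dim S \<le> CARD('a) ^ dim T"
    using assms card_mono card_subspace finite_subset by metis
  then show ?thesis using q_gt_1 by (simp add: power_increasing_iff)
qed

lemma dim_eq_imp_eq:
  assumes "subspace S" "subspace T" "finite T" "S \<subseteq> T" "dim T \<le> dim S"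
  shows "S = T"
proof -
  have "dim S = dim T" using assms dim_mono_fin by (simp add: order_antisym)
  then have "card S = card T" using assms card_subspace finite_subset by metis
  then show ?thesis using assms card_subset_eq by blast
qed

lemma dim_sums_Int_fin:
  assumes "subspace S" "subspace T" "finite S" "finite T"
  shows "dim (S + T) + dim (S \<inter> T) = dim S + dim T"
proof -
  have "CARD('a) ^ (dim (S + T) + dim (S \<inter> T)) = CARD('a) ^ (dim S + dim T)"
    using card_sums_Int[OF assms] card_subspace[of S] card_subspace[of T] assms
      card_subspace[of "S + T"] card_subspace[of "S \<inter> T"]
    by (simp add: power_add subspace_inter subspace_set_plus finite_set_plus)
  then show ?thesis by (simp only: pow_q_eq_iff)
qed

lemma adjoin:
  assumes "subspace S" "finite S" "x \<notin> S"
  shows "finite (span (insert x S))" "dim (span (insert x S)) = Suc (dim S)"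
proof -
  show f: "finite (span (insert x S))" using card_span_insert assms by blast
  have "CARD('a) ^ dim (span (insert x S)) = CARD('a) ^ Suc (dim S)"
    using card_span_insert[OF assms] f card_subspace assms by (simp add: subspace_span)
  then show "dim (span (insert x S)) = Suc (dim S)" by (simp only: pow_q_eq_iff)
qed

lemma span_insert_subspace:
  "subspace S \<Longrightarrow> span (insert x S) = {z. \<exists>c. z - scale c x \<in> S}"
  by (simp add: span_insert flip: span_eq_iff)

lemma span_insert_subset_iff:
  assumes "subspace S" "subspace K"
  shows "span (insert x S) \<subseteq> K \<longleftrightarrow> S \<subseteq> K \<and> x \<in> K"
  using assms by (meson insert_subset span_minimal span_superset subset_trans)

lemma intermediate_subspace:
  assumes "subspace S" "subspace T" "finite T" "S \<subseteq> T" "dim S \<le> m" "m \<le> dim T"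
  obtains M where "subspace M" "S \<subseteq> M" "M \<subseteq> T" "dim M = m"
proof -
  have "\<exists>M. subspace M \<and> S \<subseteq> M \<and> M \<subseteq> T \<and> dim M = m"
    using assms(5,6)
  proof (induction m rule: dec_induct)
    case base then show ?case using assms by blast
  next
    case (step n)
    then obtain M where M: "subspace M" "S \<subseteq> M" "M \<subseteq> T" "dim M = n" by auto
    then have "M \<noteq> T" using step by auto
    then obtain x where x: "x \<in> T" "x \<notin> M" using M by blast
    have "finite M" using M assms finite_subset by blast
    then have "dim (span (insert x M)) = Suc n" using adjoin M x by blast
    moreover have "span (insert x M) \<subseteq> T" using span_insert_subset_iff M x assms by blast
    moreover have "S \<subseteq> span (insert x M)" using M span_superset by blast
    ultimately show ?case using subspace_span by blast
  qed
  then show ?thesis using that by blast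
qed

lemma full_flag:
  assumes "subspace V" "finite V"
  obtains U where "\<And>i. i \<le> dim V \<Longrightarrow> subspace (U i) \<and> U i \<subseteq> V \<and> dim (U i) = i"
    "\<And>i. i < dim V \<Longrightarrow> U i \<subseteq> U (Suc i)"
proof -
  let ?P = "\<lambda>i M. i \<le> dim V \<longrightarrow> subspace M \<and> M \<subseteq> V \<and> dim M = i"
  have "\<exists>U. \<forall>i. ?P i (U i) \<and> (i < dim V \<longrightarrow> U i \<subseteq> U (Suc i))"
  proof (rule dependent_nat_choice)
    show "\<exists>x. ?P 0 x" using assms subspace_single_0 subspace_0
      by (intro exI[of _ "{0}"]) (auto simp: dim_zero)
  next
    fix M n assume M: "?P n M"
    show "\<exists>M'. ?P (Suc n) M' \<and> (n < dim V \<longrightarrow> M \<subseteq> M')"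
    proof (cases "n < dim V")
      case True
      with M obtain M' where "subspace M'" "M \<subseteq> M'" "M' \<subseteq> V" "dim M' = Suc n"
        using intermediate_subspace[of M V "Suc n"] assms by auto
      then show ?thesis by auto
    qed auto
  qed
  then show ?thesis using that by blast
qed

text \<open>Both sides count the pairs \<open>(x, K)\<close> with \<open>x\<close> in
  \<open>K - Y\<close>.\<close>

lemma sum_card_Diff:
  assumes "finite V" "finite \<C>" "\<And>K. K \<in> \<C> \<Longrightarrow> K \<subseteq> V"
  shows "(\<Sum>K\<in>\<C>. card (K - Y)) = (\<Sum>x\<in>V - Y. card {K\<in>\<C>. x \<in> K})"
proof -
  have "(\<Sum>x\<in>V - Y. card {K\<in>\<C>. x \<in> K}) = (\<Sum>K\<in>\<C>. card (K - Y))"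
  proof (rule sum_multicount_gen; (intro ballI)?)
    fix K assume "K \<in> \<C>"
    then have "{x \<in> V - Y. x \<in> K} = K - Y" using assms(3) by blast
    then show "card {x \<in> V - Y. x \<in> K} = card (K - Y)" by simp
  qed (use assms in auto)
  then show ?thesis by simp
qed

section \<open>Counting relative complements in the subspace lattice\<close>

text \<open>For \<open>T \<subseteq> Y \<subseteq> Z\<close> these are the lattice complements of
  \<open>Y\<close> in the interval from \<open>T\<close> to \<open>Z\<close>.\<close>

definition complements :: "'b set \<Rightarrow> 'b set \<Rightarrow> 'b set \<Rightarrow> 'b set set" where
  "complements T Y Z = {K. subspace K \<and> K \<inter> Y = T \<and> K + Y = Z}"

text \<open>Induction on the codimension of \<open>Y\<close> in \<open>Z\<close>, counting pairs
  \<open>(x, K)\<close> with \<open>x\<close> in \<open>K - Y\<close>. All complements contain the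
  same number of such \<open>x\<close>, and the complements through a given \<open>x\<close> are the
  complements for the enlarged pair \<open>span (insert x T)\<close>,
  \<open>span (insert x Y)\<close>, whose codimension is one lower. The result is the number of
  linear maps from \<open>Z / Y\<close> to \<open>Y / T\<close>.\<close>

lemma card_complements:
  assumes "subspace T" "subspace Y" "subspace Z" "finite Z" "T \<subseteq> Y" "Y \<subseteq> Z"
  shows "card (complements T Y Z) = CARD('a) ^ ((dim Y - dim T) * (dim Z - dim Y))"
  using assms
proof (induction "dim Z - dim Y" arbitrary: T Y)
  case 0
  then have YZ: "Y = Z" using dim_eq_imp_eq by auto
  have "complements T Y Z = {T}"
  proof (intro equalityI subsetI)
    fix K assume "K \<in> complements T Y Z"
    then have K: "subspace K" "K \<inter> Y = T" "K + Y = Z" by (auto simp: complements_def)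
    then have "K \<subseteq> Y" using sums_upper1 0 YZ by metis
    then show "K \<in> {T}" using K by auto
  next
    fix K assume K: "K \<in> {T}"
    have "Y + T = Y" using 0 sums_absorb by blast
    then have "T + Y = Z" using YZ add.commute[of T Y] by metis
    moreover have "T \<inter> Y = T" using 0 by blast
    ultimately show "K \<in> complements T Y Z" using K 0(2) unfolding complements_def by blast
  qed
  then show ?case using YZ by simp
next
  case (Suc n)
  let ?q = "CARD('a)" and ?r = "dim Y - dim T"
  have finY: "finite Y" using Suc.prems(4,6) by (rule rev_finite_subset)
  have finT: "finite T" using finY Suc.prems(5) by (rule rev_finite_subset)
  note fin = finY finT
  have dTY: "dim T \<le> dim Y" using Suc.prems fin dim_mono_fin by blast
  have dZ: "dim Z = dim Y + Suc n" using Suc.hyps(2) by simp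
  let ?C = "complements T Y Z"
  have sub: "K \<subseteq> Z" "T \<subseteq> K" "subspace K" if "K \<in> ?C" for K
    using that sums_upper1 Suc.prems by (auto simp: complements_def)
  have finC: "finite ?C"
    by (rule finite_subset[of _ "Pow Z"]) (use sub Suc.prems in auto)
  have dK: "dim K = dim T + Suc n" if "K \<in> ?C" for K
  proof -
    have "dim (K + Y) + dim (K \<inter> Y) = dim K + dim Y"
      using sub(3)[OF that] Suc.prems(2) rev_finite_subset[OF Suc.prems(4) sub(1)[OF that]] finY
      by (rule dim_sums_Int_fin)
    then show ?thesis using that dZ by (simp add: complements_def)
  qed
  have diff: "card (K - Y) = ?q ^ dim T * (?q ^ Suc n - 1)" if "K \<in> ?C" for K
  proof -
    have "finite K" using Suc.prems(4) sub(1)[OF that] by (rule rev_finite_subset)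
    have "K - Y = K - T" using that by (auto simp: complements_def)
    then have "card (K - Y) = card K - card T" using sub[OF that] fin by (simp add: card_Diff_subset)
    then show ?thesis using card_subspace sub[OF that] \<open>finite K\<close> dK[OF that] Suc.prems fin
      by (simp add: power_add diff_mult_distrib2 mult.left_commute)
  qed
  have each: "card {K\<in>?C. x \<in> K} = ?q ^ (?r * n)" if x: "x \<in> Z - Y" for x
  proof -
    let ?T = "span (insert x T)" and ?Y = "span (insert x Y)"
    have xT: "x \<notin> T" using x Suc.prems by blast
    have eq: "{K\<in>?C. x \<in> K} = complements ?T ?Y Z"
    proof (intro equalityI subsetI)
      fix K assume "K \<in> {K\<in>?C. x \<in> K}"
      then have K: "subspace K" "K \<inter> Y = T" "K + Y = Z" "x \<in> K" "T \<subseteq> K"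
        by (auto simp: complements_def)
      have "?Y \<subseteq> Z" using span_insert_subset_iff x Suc.prems by blast
      have "K + ?Y = Z"
      proof
        show "K + ?Y \<subseteq> Z" using K \<open>?Y \<subseteq> Z\<close> Suc.prems sums_least sums_upper1 by metis
        have "Y \<subseteq> ?Y" using span_superset by blast
        then show "Z \<subseteq> K + ?Y" using K(3) sums_mono by blast
      qed
      moreover have "K \<inter> ?Y = ?T"
      proof
        show "?T \<subseteq> K \<inter> ?Y"
          using K Suc.prems span_mono[of "insert x T" "insert x Y"] span_insert_subset_iff
          by (meson Int_subset_iff insert_mono)
        show "K \<inter> ?Y \<subseteq> ?T"
        proof
          fix z assume z: "z \<in> K \<inter> ?Y"
          then obtain c where c: "z - scale c x \<in> Y" using Suc.prems by (auto simp: span_insert_subspace)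
          moreover have "z - scale c x \<in> K" using z K subspace_diff subspace_scale by blast
          ultimately have "z - scale c x \<in> T" using K by blast
          then show "z \<in> ?T" using Suc.prems by (auto simp: span_insert_subspace)
        qed
      qed
      ultimately show "K \<in> complements ?T ?Y Z" using K by (simp add: complements_def)
    next
      fix K assume "K \<in> complements ?T ?Y Z"
      then have K: "subspace K" "K \<inter> ?Y = ?T" "K + ?Y = Z" by (auto simp: complements_def)
      have xK: "x \<in> K" "T \<subseteq> K" using K(2) span_superset[of "insert x T"] by auto
      have "K \<inter> Y = T"
      proof
        show "T \<subseteq> K \<inter> Y" using xK Suc.prems by blast
        show "K \<inter> Y \<subseteq> T"
        proof
          fix z assume z: "z \<in> K \<inter> Y"
          then have "z \<in> ?Y" using span_superset by blast
          then have "z \<in> ?T" using z K by blast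
          then obtain c where c: "z - scale c x \<in> T" using Suc.prems by (auto simp: span_insert_subspace)
          \<comment> \<open>Since \<open>z\<close> and \<open>z - scale c x\<close> both lie in
            \<open>Y\<close>, so does \<open>scale c x\<close>; but \<open>x\<close> is outside
            \<open>Y\<close>.\<close>
          have "c = 0"
          proof (rule ccontr)
            assume "c \<noteq> 0"
            have "z - (z - scale c x) \<in> Y" using z c Suc.prems subspace_diff by blast
            then have "scale c x \<in> Y" by simp
            then have "scale (inverse c) (scale c x) \<in> Y" by (rule subspace_scale[OF Suc.prems(2)])
            then show False using \<open>c \<noteq> 0\<close> x by simp
          qed
          then show "z \<in> T" using c by simp
        qed
      qed
      moreover have "K + Y = Z"
      proof
        show "K + Y \<subseteq> Z" using K(3) sums_mono[of K K Y ?Y] span_superset[of "insert x Y"] by blast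
        have "?Y \<subseteq> K + Y"
          using span_insert_subset_iff[of Y "K + Y"] K Suc.prems subspace_set_plus
            sums_upper1[of Y K] sums_upper2[of K Y] xK by blast
        then have "K + ?Y \<subseteq> K + Y"
          using sums_least K Suc.prems subspace_set_plus sums_upper1 by metis
        then show "Z \<subseteq> K + Y" using K by blast
      qed
      ultimately show "K \<in> {K\<in>?C. x \<in> K}" using K xK by (auto simp: complements_def)
    qed
    have "card (complements ?T ?Y Z) = ?q ^ ((dim ?Y - dim ?T) * (dim Z - dim ?Y))"
    proof (rule Suc.hyps(1))
      show "n = dim Z - dim ?Y" using adjoin(2)[of Y x] x dZ Suc.prems fin by auto
      show "?T \<subseteq> ?Y" using Suc.prems by (intro span_mono) auto
      show "?Y \<subseteq> Z" using span_insert_subset_iff x Suc.prems by blast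
    qed (use Suc.prems subspace_span in auto)
    moreover have "dim ?Y = Suc (dim Y)" "dim ?T = Suc (dim T)"
      using adjoin(2) x xT Suc.prems fin by auto
    ultimately show ?thesis using eq dZ by simp
  qed
  have "(\<Sum>K\<in>?C. card (K - Y)) = (\<Sum>x\<in>Z - Y. card {K\<in>?C. x \<in> K})"
    by (rule sum_card_Diff) (use Suc.prems finC sub in auto)
  then have "card ?C * (?q ^ dim T * (?q ^ Suc n - 1)) = card (Z - Y) * ?q ^ (?r * n)"
    using diff each by simp
  also have "card (Z - Y) = ?q ^ dim Y * (?q ^ Suc n - 1)"
    using card_subspace Suc.prems fin dZ
    by (simp add: card_Diff_subset power_add diff_mult_distrib2 mult.left_commute)
  also have "?q ^ dim Y = ?q ^ dim T * ?q ^ ?r" using dTY by (simp flip: power_add)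
  \<comment> \<open>Both sides carry the number of points of a complement outside \<open>Y\<close>
    as a factor. It is positive and can be cancelled.\<close>
  finally have "(?q ^ dim T * (?q ^ Suc n - 1)) * card ?C
      = (?q ^ dim T * (?q ^ Suc n - 1)) * (?q ^ ?r * ?q ^ (?r * n))"
    by (simp only: ac_simps)
  moreover have "?q ^ Suc n > 1" using q_gt_1 by (rule one_less_power) simp
  ultimately have "card ?C = ?q ^ ?r * ?q ^ (?r * n)" by (subst (asm) mult_cancel1) auto
  also have "\<dots> = ?q ^ (?r * Suc n)" by (simp add: power_add)
  finally show ?case using dZ by simp
qed

text \<open>Replacing \<open>T\<close> by \<open>T + K1\<close>, the spaces counted are the complements of \<open>T + X\<close> over \<open>T + K1\<close>.\<close>

lemma card_join_fibre:
  assumes "subspace X" "subspace V" "finite V" "subspace T" "T \<subseteq> V"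
    and "subspace K1" "K1 \<subseteq> X" "T \<inter> X \<subseteq> K1" "subspace K2" "X \<subseteq> K2" "T + X \<subseteq> K2" "K2 \<subseteq> V"
  shows "card {K. subspace K \<and> T \<subseteq> K \<and> K \<inter> X = K1 \<and> K + X = K2}
    = CARD('a) ^ ((dim X - dim K1) * (dim K2 - dim (T + X)))"
proof -
  have TK2: "T \<subseteq> K2" using sums_upper1 assms by blast
  have fin: "finite K1" "finite K2" "finite X" "finite T" using assms finite_subset by metis+
  let ?S = "T + K1" and ?Y = "T + X"
  have sub: "subspace ?S" "subspace ?Y" using assms subspace_set_plus by auto
  have SX: "?S \<inter> X = K1"
  proof -
    have "?S \<inter> X = (K1 + T) \<inter> X" by (simp add: add.commute)
    also have "\<dots> = K1 + (T \<inter> X)" by (rule modular_law) (use assms in auto)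
    also have "\<dots> = K1" by (rule sums_absorb) (use assms subspace_inter in auto)
    finally show ?thesis .
  qed
  have SX': "?S + X = ?Y"
    using sums_absorb[OF assms(1,6,7)] by (metis add.assoc add.commute)
  have "{K. subspace K \<and> T \<subseteq> K \<and> K \<inter> X = K1 \<and> K + X = K2} = complements ?S ?Y K2"
  proof (intro equalityI subsetI)
    fix K assume "K \<in> {K. subspace K \<and> T \<subseteq> K \<and> K \<inter> X = K1 \<and> K + X = K2}"
    then have K: "subspace K" "T \<subseteq> K" "K \<inter> X = K1" "K + X = K2" by auto
    have "(T + X) \<inter> K = T + (X \<inter> K)" by (rule modular_law) (use K assms in auto)
    then have "K \<inter> ?Y = ?S" using K by (simp add: Int_commute)
    moreover have "K + ?Y = K2" using K assms sums_absorb[of K T] by (simp flip: add.assoc)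
    ultimately show "K \<in> complements ?S ?Y K2" using K by (simp add: complements_def)
  next
    fix K assume "K \<in> complements ?S ?Y K2"
    then have K: "subspace K" "K \<inter> ?Y = ?S" "K + ?Y = K2" by (auto simp: complements_def)
    have TK: "T \<subseteq> K" using K sums_upper1[of K1 T] assms by blast
    have "X \<subseteq> ?Y" using sums_upper2 assms by blast
    then have "K \<inter> X = (K \<inter> ?Y) \<inter> X" by blast
    then have "K \<inter> X = K1" using K SX by simp
    moreover have "K + X = K2" using K assms sums_absorb[of K T] TK by (simp flip: add.assoc)
    ultimately show "K \<in> {K. subspace K \<and> T \<subseteq> K \<and> K \<inter> X = K1 \<and> K + X = K2}" using K TK by simp
  qed
  moreover have "card (complements ?S ?Y K2) = CARD('a) ^ ((dim ?Y - dim ?S) * (dim K2 - dim ?Y))"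
    by (rule card_complements)
      (use assms sub fin sums_mono[of T T K1 X] in auto)
  \<comment> \<open>By the dimension formula for \<open>T + K1\<close> and \<open>X\<close>, which
    meet in \<open>K1\<close>, this factor of the exponent is independent of
    \<open>T\<close>.\<close>
  moreover have "dim ?Y - dim ?S = dim X - dim K1"
  proof -
    have "dim (?S + X) + dim (?S \<inter> X) = dim ?S + dim X"
      by (rule dim_sums_Int_fin) (use assms sub fin finite_set_plus in auto)
    then have "dim ?Y + dim K1 = dim ?S + dim X" by (simp only: SX SX')
    then show ?thesis by simp
  qed
  ultimately show ?thesis by simp
qed

subsection \<open>Balanced colourings\<close>

text \<open>These are the \<open>a\<close>-dimensional subspaces of the quotient
  \<open>V / X\<close>, represented by their preimages in \<open>V\<close>. Quotients and iterated
  quotients thus stay inside one vector space.\<close>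

definition interval :: "'b set \<Rightarrow> 'b set \<Rightarrow> nat \<Rightarrow> 'b set set" where
  "interval X V a = {K. subspace K \<and> X \<subseteq> K \<and> K \<subseteq> V \<and> dim K = dim X + a}"

text \<open>
  Here \<open>s\<close> is the strength \<open>t\<close> plus 1: the shift makes the parameter additive under joins and admits
  the trivial case \<open>t = -1\<close>.
\<close>

definition balanced :: "nat \<Rightarrow> nat \<Rightarrow> 'b set \<Rightarrow> 'b set \<Rightarrow> 'b set set \<Rightarrow> ('b set \<Rightarrow> nat) \<Rightarrow> bool" where
  "balanced N s X V \<B> f \<longleftrightarrow> (\<forall>K\<in>\<B>. f K < N) \<and>
     (\<forall>T. subspace T \<and> X \<subseteq> T \<and> T \<subseteq> V \<and> dim T < dim X + s \<longrightarrow>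
       (\<exists>l. \<forall>i<N. card {K\<in>\<B>. T \<subseteq> K \<and> f K = i} = l))"

definition partitionable :: "nat \<Rightarrow> nat \<Rightarrow> 'b set \<Rightarrow> 'b set \<Rightarrow> 'b set set \<Rightarrow> bool" where
  "partitionable N s X V \<B> \<longleftrightarrow> (\<exists>f. balanced N s X V \<B> f)"

text \<open>\<open>LS N a b s\<close> stands for the existence of an \<open>LS\<^sub>q[N](s - 1, a, a + b)\<close>.\<close>

definition LS :: "nat \<Rightarrow> nat \<Rightarrow> nat \<Rightarrow> nat \<Rightarrow> bool" where
  "LS N a b s \<longleftrightarrow> (\<exists>X V. subspace X \<and> subspace V \<and> finite V \<and> X \<subseteq> V \<and> dim V = dim X + a + b \<and>
     partitionable N s X V (interval X V a))"

section \<open>Transport of colourings between quotients of equal dimension\<close>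

lemma adapted_basis:
  assumes "subspace X" "subspace V" "finite V" "X \<subseteq> V"
  obtains A B where "A \<subseteq> B" "independent B" "finite B" "span A = X" "span B = V"
    "card A = dim X" "card B = dim V"
proof -
  obtain A where A: "A \<subseteq> X" "independent A" "X \<subseteq> span A" "card A = dim X"
    using basis_exists by blast
  have "A \<subseteq> V" using A assms by blast
  then obtain B where B: "A \<subseteq> B" "B \<subseteq> V" "independent B" "V \<subseteq> span B"
    using maximal_independent_subset_extend[OF _ A(2)] by blast
  have sp: "span A = X" "span B = V"
    using A B assms by (simp_all add: span_minimal subset_antisym)
  moreover have "card B = dim V" using B basis_card_eq_dim by blast
  moreover have "finite B" using B(2) assms(3) by (rule finite_subset)
  ultimately show ?thesis using that A B by blast
qed

text \<open>The maps represent mutually inverse isomorphisms between \<open>V / X\<close> and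
  \<open>V' / X'\<close>, hence the identities only modulo \<open>X\<close> and \<open>X'\<close>.
  On adapted bases they kill the part spanning \<open>X\<close> or \<open>X'\<close> and match the
  remaining basis vectors, which are equally many by \<open>d\<close>.\<close>

lemma quotient_isomorphisms:
  assumes X: "subspace X" "subspace V" "finite V" "X \<subseteq> V"
    and X': "subspace X'" "subspace V'" "finite V'" "X' \<subseteq> V'"
    and d: "dim V + dim X' = dim V' + dim X"
  obtains \<phi> \<psi> where "Vector_Spaces.linear scale scale \<phi>" "Vector_Spaces.linear scale scale \<psi>"
    "\<phi> ` V \<subseteq> V'" "\<psi> ` V' \<subseteq> V" "\<And>x. x \<in> X \<Longrightarrow> \<phi> x = 0" "\<And>y. y \<in> X' \<Longrightarrow> \<psi> y = 0"
    "\<And>x. x \<in> V \<Longrightarrow> \<psi> (\<phi> x) - x \<in> X" "\<And>y. y \<in> V' \<Longrightarrow> \<phi> (\<psi> y) - y \<in> X'"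
proof -
  interpret vp: vector_space_pair scale scale ..
  obtain A B where AB: "A \<subseteq> B" "independent B" "finite B" "span A = X" "span B = V"
    "card A = dim X" "card B = dim V" by (rule adapted_basis[OF X])
  obtain A' B' where AB': "A' \<subseteq> B'" "independent B'" "finite B'" "span A' = X'" "span B' = V'"
    "card A' = dim X'" "card B' = dim V'" by (rule adapted_basis[OF X'])
  have "card (B - A) = card (B' - A')"
    using AB AB' d by (simp add: card_Diff_subset finite_subset)
  then obtain \<beta> where \<beta>: "bij_betw \<beta> (B - A) (B' - A')"
    using AB AB' finite_same_card_bij by blast
  define \<gamma> where "\<gamma> = inv_into (B - A) \<beta>"
  obtain \<phi> where \<phi>: "Vector_Spaces.linear scale scale \<phi>"
      "\<And>x. x \<in> B \<Longrightarrow> \<phi> x = (if x \<in> A then 0 else \<beta> x)"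
    using vp.linear_independent_extend[OF AB(2), of "\<lambda>x. if x \<in> A then 0 else \<beta> x"] by blast
  obtain \<psi> where \<psi>: "Vector_Spaces.linear scale scale \<psi>"
      "\<And>x. x \<in> B' \<Longrightarrow> \<psi> x = (if x \<in> A' then 0 else \<gamma> x)"
    using vp.linear_independent_extend[OF AB'(2), of "\<lambda>x. if x \<in> A' then 0 else \<gamma> x"] by blast
  interpret f: Vector_Spaces.linear scale scale \<phi> by (rule \<phi>(1))
  interpret g: Vector_Spaces.linear scale scale \<psi> by (rule \<psi>(1))
  have \<beta>B: "\<beta> x \<in> B'" "\<beta> x \<notin> A'" "\<gamma> (\<beta> x) = x" if "x \<in> B" "x \<notin> A" for x
    using that \<beta> by (auto simp: bij_betw_def \<gamma>_def)
  have \<gamma>B: "\<gamma> x \<in> B" "\<gamma> x \<notin> A" "\<beta> (\<gamma> x) = x" if "x \<in> B'" "x \<notin> A'" for x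
    using that \<beta> inv_into_into[of x \<beta> "B - A"] f_inv_into_f[of x \<beta> "B - A"]
    by (auto simp: bij_betw_def \<gamma>_def)
  have ind: "P x" if "x \<in> span C" "\<And>x. x \<in> C \<Longrightarrow> P x" "subspace {x. P x}" for P C x
    using that span_minimal[of C "{x. P x}"] by auto
  have B': "0 \<in> V'" "\<And>b. b \<in> B' \<Longrightarrow> b \<in> V'" using X' AB' subspace_0 span_superset by blast+
  have B0: "0 \<in> V" "\<And>b. b \<in> B \<Longrightarrow> b \<in> V" using X AB subspace_0 span_superset by blast+
  show ?thesis
  proof (rule that[OF \<phi>(1) \<psi>(1)])
    have "\<phi> x \<in> V'" if "x \<in> span B" for x
    proof (rule ind[OF that])
      show "subspace {x. \<phi> x \<in> V'}"
        using X'(2) by (auto simp: subspace_def f.add f.scale f.zero)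
    qed (use \<phi> \<beta>B B' in auto)
    then show "\<phi> ` V \<subseteq> V'" using AB by auto
    have "\<psi> x \<in> V" if "x \<in> span B'" for x
    proof (rule ind[OF that])
      show "subspace {x. \<psi> x \<in> V}"
        using X(2) by (auto simp: subspace_def g.add g.scale g.zero)
    qed (use \<psi> \<gamma>B B0 in auto)
    then show "\<psi> ` V' \<subseteq> V" using AB' by auto
    show "\<phi> x = 0" if "x \<in> X" for x
    proof (rule ind[of x A])
      show "subspace {x. \<phi> x = 0}" by (auto simp: subspace_def f.add f.scale f.zero)
    qed (use that AB \<phi> in auto)
    show "\<psi> x = 0" if "x \<in> X'" for x
    proof (rule ind[of x A'])
      show "subspace {x. \<psi> x = 0}" by (auto simp: subspace_def g.add g.scale g.zero)
    qed (use that AB' \<psi> in auto)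
    show "\<psi> (\<phi> x) - x \<in> X" if "x \<in> V" for x
    proof (rule ind[of x B])
      show "subspace {x. \<psi> (\<phi> x) - x \<in> X}"
      proof (rule subspaceI)
        fix x y assume "x \<in> {x. \<psi> (\<phi> x) - x \<in> X}" "y \<in> {x. \<psi> (\<phi> x) - x \<in> X}"
        then have "(\<psi> (\<phi> x) - x) + (\<psi> (\<phi> y) - y) \<in> X" using X subspace_add by blast
        then show "x + y \<in> {x. \<psi> (\<phi> x) - x \<in> X}" by (simp add: f.add g.add algebra_simps)
      next
        fix c x assume "x \<in> {x. \<psi> (\<phi> x) - x \<in> X}"
        then have "scale c (\<psi> (\<phi> x) - x) \<in> X" using X subspace_scale by blast
        then show "scale c x \<in> {x. \<psi> (\<phi> x) - x \<in> X}"
          by (simp add: f.scale g.scale scale_right_diff_distrib)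
      qed (use X subspace_0 in \<open>auto simp: f.zero g.zero\<close>)
      show "\<psi> (\<phi> x) - x \<in> X" if "x \<in> B" for x
      proof (cases "x \<in> A")
        case True
        then have "x \<in> X" using AB span_superset by blast
        then show ?thesis using True that \<phi> g.zero X subspace_neg by simp
      next
        case False
        then show ?thesis using that \<phi> \<psi> \<beta>B X subspace_0 by simp
      qed
    qed (use that AB in auto)
    show "\<phi> (\<psi> x) - x \<in> X'" if "x \<in> V'" for x
    proof (rule ind[of x B'])
      show "subspace {x. \<phi> (\<psi> x) - x \<in> X'}"
      proof (rule subspaceI)
        fix x y assume "x \<in> {x. \<phi> (\<psi> x) - x \<in> X'}" "y \<in> {x. \<phi> (\<psi> x) - x \<in> X'}"
        then have "(\<phi> (\<psi> x) - x) + (\<phi> (\<psi> y) - y) \<in> X'" using X' subspace_add by blast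
        then show "x + y \<in> {x. \<phi> (\<psi> x) - x \<in> X'}" by (simp add: f.add g.add algebra_simps)
      next
        fix c x assume "x \<in> {x. \<phi> (\<psi> x) - x \<in> X'}"
        then have "scale c (\<phi> (\<psi> x) - x) \<in> X'" using X' subspace_scale by blast
        then show "scale c x \<in> {x. \<phi> (\<psi> x) - x \<in> X'}"
          by (simp add: f.scale g.scale scale_right_diff_distrib)
      qed (use X' subspace_0 in \<open>auto simp: f.zero g.zero\<close>)
      show "\<phi> (\<psi> x) - x \<in> X'" if "x \<in> B'" for x
      proof (cases "x \<in> A'")
        case True
        then have "x \<in> X'" using AB' span_superset by blast
        then show ?thesis using True that \<psi> f.zero X' subspace_neg by simp
      next
        case False
        then show ?thesis using that \<phi> \<psi> \<gamma>B X' subspace_0 by simp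
      qed
    qed (use that AB' in auto)
  qed
qed

lemma finite_interval: "finite V \<Longrightarrow> finite (interval X V a)"
  by (rule finite_subset[of _ "Pow V"]) (auto simp: interval_def)

text \<open>The dimension of the preimage \<open>?L\<close> comes from counting the pairs
  \<open>(x, y)\<close> in \<open>K \<times> ?L\<close> with \<open>\<psi> y - x\<close> in
  \<open>X\<close>: each \<open>y\<close> occurs in \<open>card X\<close> pairs and each
  \<open>x\<close> in \<open>card X'\<close> pairs.\<close>

lemma preimage_in_interval:
  assumes lin: "Vector_Spaces.linear scale scale \<phi>" "Vector_Spaces.linear scale scale \<psi>"
    and h: "\<phi> ` V \<subseteq> V'" "\<psi> ` V' \<subseteq> V" "\<And>x. x \<in> X \<Longrightarrow> \<phi> x = 0" "\<And>y. y \<in> X' \<Longrightarrow> \<psi> y = 0"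
      "\<And>x. x \<in> V \<Longrightarrow> \<psi> (\<phi> x) - x \<in> X" "\<And>y. y \<in> V' \<Longrightarrow> \<phi> (\<psi> y) - y \<in> X'"
    and X: "subspace X" "finite V" "X \<subseteq> V"
    and X': "subspace X'" "subspace V'" "finite V'" "X' \<subseteq> V'"
    and K0: "K \<in> interval X V a"
  shows "{y \<in> V'. \<psi> y \<in> K} \<in> interval X' V' a"
proof -
  interpret f: Vector_Spaces.linear scale scale \<phi> by (rule lin(1))
  interpret g: Vector_Spaces.linear scale scale \<psi> by (rule lin(2))
  let ?L = "{y \<in> V'. \<psi> y \<in> K}"
  have K: "subspace K" "X \<subseteq> K" "K \<subseteq> V" "dim K = dim X + a" using K0 by (auto simp: interval_def)
  have fin: "finite K" "finite X" "finite X'" "finite ?L"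
    using K X(2) X(3) X'(3) X'(4) by (auto intro: finite_subset)
  have sL: "subspace ?L"
    using K(1) X'(2) by (auto simp: subspace_def g.add g.scale g.zero)
  have XL: "X' \<subseteq> ?L" using h(4) X'(4) K(1) subspace_0 by auto
  \<comment> \<open>The relation that is counted is the graph of the quotient isomorphism, so it can
    be read modulo \<open>X\<close> or modulo \<open>X'\<close>.\<close>
  have iff: "\<psi> y - x \<in> X \<longleftrightarrow> y - \<phi> x \<in> X'" if x: "x \<in> V" and y: "y \<in> V'" for x y
  proof
    assume "\<psi> y - x \<in> X"
    then have "\<phi> (\<psi> y) = \<phi> x" using h(3) f.diff by fastforce
    then have "\<phi> x - y \<in> X'" using h(6) y by metis
    then show "y - \<phi> x \<in> X'" using X'(1) subspace_neg minus_diff_eq by metis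
  next
    assume "y - \<phi> x \<in> X'"
    then have "\<psi> y = \<psi> (\<phi> x)" using h(4) g.diff by fastforce
    then show "\<psi> y - x \<in> X" using h(5) x by metis
  qed
  have "(\<Sum>x\<in>K. card {y \<in> ?L. \<psi> y - x \<in> X}) = (\<Sum>y\<in>?L. card X)"
  proof (rule sum_multicount_gen; (intro ballI)?)
    fix y assume y: "y \<in> ?L"
    have "{x \<in> K. \<psi> y - x \<in> X} = (\<lambda>z. \<psi> y - z) ` X"
    proof (intro equalityI subsetI)
      fix x assume "x \<in> {x \<in> K. \<psi> y - x \<in> X}"
      then show "x \<in> (\<lambda>z. \<psi> y - z) ` X" by (intro image_eqI[of _ _ "\<psi> y - x"]) auto
    qed (use y K subspace_diff in auto)
    then show "card {x \<in> K. \<psi> y - x \<in> X} = card X" by (simp add: card_image inj_on_def)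
  qed (use fin in auto)
  moreover have "card {y \<in> ?L. \<psi> y - x \<in> X} = card X'" if x: "x \<in> K" for x
  proof -
    have xV: "x \<in> V" "\<phi> x \<in> V'" using x K h(1) by auto
    have "{y \<in> ?L. \<psi> y - x \<in> X} = (\<lambda>z. \<phi> x + z) ` X'"
    proof (intro equalityI subsetI)
      fix y assume "y \<in> {y \<in> ?L. \<psi> y - x \<in> X}"
      then show "y \<in> (\<lambda>z. \<phi> x + z) ` X'" using iff[OF xV(1)]
        by (intro image_eqI[of _ _ "y - \<phi> x"]) auto
    next
      fix y assume "y \<in> (\<lambda>z. \<phi> x + z) ` X'"
      then obtain z where z: "z \<in> X'" "y = \<phi> x + z" by blast
      then have y: "y \<in> V'" "y - \<phi> x \<in> X'" using xV X' subspace_add by auto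
      then have "\<psi> y - x \<in> X" using iff xV by blast
      moreover from this have "(\<psi> y - x) + x \<in> K" using K x subspace_add by blast
      ultimately show "y \<in> {y \<in> ?L. \<psi> y - x \<in> X}" using y by simp
    qed
    then show ?thesis by (simp add: card_image inj_on_def)
  qed
  ultimately have "card K * card X' = card ?L * card X" by simp
  then have "CARD('a) ^ (dim K + dim X') = CARD('a) ^ (dim ?L + dim X)"
    using card_subspace K(1) X(1) X'(1) sL fin by (simp add: power_add)
  then have "dim ?L = dim X' + a" using K(4) unfolding pow_q_eq_iff by simp
  then show ?thesis using sL XL by (auto simp: interval_def)
qed

text \<open>Taking preimages is monotone, and \<open>\<phi>\<close> and \<open>\<psi>\<close> are
  inverse modulo spaces contained in every member of the intervals. A single pair \<open>F\<close>,
  \<open>G\<close> serves all ranks \<open>a\<close>, since a block and the test space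
  \<open>T\<close> have different ranks.\<close>

lemma interval_isomorphism:
  assumes X: "subspace X" "subspace V" "finite V" "X \<subseteq> V"
    and X': "subspace X'" "subspace V'" "finite V'" "X' \<subseteq> V'"
    and d: "dim V + dim X' = dim V' + dim X"
  obtains F G where
    "\<And>a. F ` interval X V a \<subseteq> interval X' V' a" "\<And>a. G ` interval X' V' a \<subseteq> interval X V a"
    "\<And>K a. K \<in> interval X V a \<Longrightarrow> G (F K) = K" "\<And>K a. K \<in> interval X' V' a \<Longrightarrow> F (G K) = K"
    "mono F" "mono G"
proof -
  obtain \<phi> \<psi> where lin: "Vector_Spaces.linear scale scale \<phi>" "Vector_Spaces.linear scale scale \<psi>"
    and h: "\<phi> ` V \<subseteq> V'" "\<psi> ` V' \<subseteq> V" "\<And>x. x \<in> X \<Longrightarrow> \<phi> x = 0" "\<And>y. y \<in> X' \<Longrightarrow> \<psi> y = 0"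
    "\<And>x. x \<in> V \<Longrightarrow> \<psi> (\<phi> x) - x \<in> X" "\<And>y. y \<in> V' \<Longrightarrow> \<phi> (\<psi> y) - y \<in> X'"
    using quotient_isomorphisms[OF assms] by metis
  show ?thesis
  proof (rule that[of "\<lambda>K. {y \<in> V'. \<psi> y \<in> K}" "\<lambda>K. {x \<in> V. \<phi> x \<in> K}"])
    show "(\<lambda>K. {y \<in> V'. \<psi> y \<in> K}) ` interval X V a \<subseteq> interval X' V' a" for a
      using preimage_in_interval[OF lin h X(1,3,4) X'] by auto
    show "(\<lambda>K. {x \<in> V. \<phi> x \<in> K}) ` interval X' V' a \<subseteq> interval X V a" for a
      using preimage_in_interval[OF lin(2,1) h(2,1,4,3,6,5) X'(1,3,4) X] by auto
    show "{x \<in> V. \<phi> x \<in> {y \<in> V'. \<psi> y \<in> K}} = K" if "K \<in> interval X V a" for K a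
    proof -
      have K: "subspace K" "X \<subseteq> K" "K \<subseteq> V" using that by (auto simp: interval_def)
      have "\<psi> (\<phi> x) \<in> K \<longleftrightarrow> x \<in> K" if "x \<in> V" for x
        using h(5)[OF that] K subspace_diff[of K "\<psi> (\<phi> x)" "\<psi> (\<phi> x) - x"]
          subspace_add[of K "\<psi> (\<phi> x) - x" x] by auto
      then show ?thesis using K h(1) by blast
    qed
    show "{y \<in> V'. \<psi> y \<in> {x \<in> V. \<phi> x \<in> K}} = K" if "K \<in> interval X' V' a" for K a
    proof -
      have K: "subspace K" "X' \<subseteq> K" "K \<subseteq> V'" using that by (auto simp: interval_def)
      have "\<phi> (\<psi> x) \<in> K \<longleftrightarrow> x \<in> K" if "x \<in> V'" for x
        using h(6)[OF that] K subspace_diff[of K "\<phi> (\<psi> x)" "\<phi> (\<psi> x) - x"]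
          subspace_add[of K "\<phi> (\<psi> x) - x" x] by auto
      then show ?thesis using K h(2) by blast
    qed
  qed (auto intro: monoI)
qed

lemma transport_count:
  assumes "F ` I \<subseteq> I'" "G ` I' \<subseteq> I" "\<And>K. K \<in> I \<Longrightarrow> G (F K) = K" "\<And>K. K \<in> I' \<Longrightarrow> F (G K) = K"
    and "mono F" "mono G" "F (G T) = T"
  shows "card {K\<in>I'. T \<subseteq> K \<and> f (G K) = i} = card {K\<in>I. G T \<subseteq> K \<and> f K = i}"
proof -
  have "bij_betw G {K\<in>I'. T \<subseteq> K \<and> f (G K) = i} {K\<in>I. G T \<subseteq> K \<and> f K = i}"
  proof (rule bij_betw_byWitness[where f' = F])
    show "G ` {K\<in>I'. T \<subseteq> K \<and> f (G K) = i} \<subseteq> {K\<in>I. G T \<subseteq> K \<and> f K = i}"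
      using assms(2) monoD[OF assms(6)] by auto
    show "F ` {K\<in>I. G T \<subseteq> K \<and> f K = i} \<subseteq> {K\<in>I'. T \<subseteq> K \<and> f (G K) = i}"
    proof
      fix L assume "L \<in> F ` {K\<in>I. G T \<subseteq> K \<and> f K = i}"
      then obtain K where K: "K \<in> I" "G T \<subseteq> K" "f K = i" "L = F K" by blast
      then have "F (G T) \<subseteq> F K" using monoD[OF assms(5)] by blast
      then show "L \<in> {K\<in>I'. T \<subseteq> K \<and> f (G K) = i}" using K assms(1,3,7) by auto
    qed
  qed (use assms(3,4) in auto)
  then show ?thesis by (rule bij_betw_same_card)
qed

text \<open>\<open>LS\<close> asks for one pair of spaces; the lattice isomorphism carries the
  colouring to every pair with the same relative dimensions. Hence \<open>LS\<close> can be used on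
  any section of a flag.\<close>

lemma LS_imp_partitionable:
  assumes "LS N a b s" and X': "subspace X'" "subspace V'" "finite V'" "X' \<subseteq> V'" "dim V' = dim X' + a + b"
  shows "partitionable N s X' V' (interval X' V' a)"
proof -
  obtain X V f where X: "subspace X" "subspace V" "finite V" "X \<subseteq> V" "dim V = dim X + a + b"
    and f: "balanced N s X V (interval X V a) f"
    using assms(1) unfolding LS_def partitionable_def by blast
  have "dim V + dim X' = dim V' + dim X" using X X' by simp
  then obtain F G where FG: "\<And>a. F ` interval X V a \<subseteq> interval X' V' a"
      "\<And>a. G ` interval X' V' a \<subseteq> interval X V a"
    and inv: "\<And>K a. K \<in> interval X V a \<Longrightarrow> G (F K) = K" "\<And>K a. K \<in> interval X' V' a \<Longrightarrow> F (G K) = K"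
    and m: "mono F" "mono G"
    using interval_isomorphism[OF X(1-4) X'(1-4)] by metis
  have "balanced N s X' V' (interval X' V' a) (f \<circ> G)"
    unfolding balanced_def
  proof (intro conjI ballI allI impI)
    fix K assume "K \<in> interval X' V' a"
    then show "(f \<circ> G) K < N" using f FG(2) by (auto simp: balanced_def)
  next
    fix T assume T: "subspace T \<and> X' \<subseteq> T \<and> T \<subseteq> V' \<and> dim T < dim X' + s"
    define t where "t = dim T - dim X'"
    have "dim X' \<le> dim T" by (rule dim_mono_fin) (use T X' finite_subset in auto)
    then have t: "T \<in> interval X' V' t" "t < s" using T by (auto simp: interval_def t_def)
    then have GT: "G T \<in> interval X V t" using FG(2) by blast
    then have "\<exists>l. \<forall>i<N. card {K \<in> interval X V a. G T \<subseteq> K \<and> f K = i} = l"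
      using f t(2) unfolding balanced_def interval_def by auto
    moreover have "card {K \<in> interval X' V' a. T \<subseteq> K \<and> (f \<circ> G) K = i}
        = card {K \<in> interval X V a. G T \<subseteq> K \<and> f K = i}" for i
      unfolding o_apply by (rule transport_count[OF FG[of a] inv[of _ a] m inv(2)[OF t(1)]])
    ultimately show "\<exists>l. \<forall>i<N. card {K \<in> interval X' V' a. T \<subseteq> K \<and> (f \<circ> G) K = i} = l"
      by (simp only:)
  qed
  then show ?thesis unfolding partitionable_def by blast
qed

section \<open>Derived and residual large sets\<close>

text \<open>Keep the colouring, but only on blocks through a fixed \<open>L\<close> of rank one over
  \<open>X\<close>. A test space over \<open>L\<close> has rank over \<open>X\<close> larger by one,
  which costs one unit of strength.\<close>

lemma LS_derived:
  assumes "LS N (Suc a) b (Suc s)"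
  shows "LS N a b s"
proof -
  obtain X V f where X: "subspace X" "subspace V" "finite V" "X \<subseteq> V" "dim V = dim X + Suc a + b"
    and f: "balanced N (Suc s) X V (interval X V (Suc a)) f"
    using assms(1) unfolding LS_def partitionable_def by blast
  obtain L where L: "subspace L" "X \<subseteq> L" "L \<subseteq> V" "dim L = Suc (dim X)"
    by (rule intermediate_subspace[OF X(1-4), of "Suc (dim X)"]) (simp_all add: X(5))
  have "balanced N s L V (interval L V a) f"
    unfolding balanced_def
  proof (intro conjI ballI allI impI)
    fix K assume "K \<in> interval L V a"
    then have "K \<in> interval X V (Suc a)" using L by (auto simp: interval_def)
    then show "f K < N" using f by (simp add: balanced_def)
  next
    fix T assume T: "subspace T \<and> L \<subseteq> T \<and> T \<subseteq> V \<and> dim T < dim L + s"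
    then have "subspace T \<and> X \<subseteq> T \<and> T \<subseteq> V \<and> dim T < dim X + Suc s" using L by auto
    then have "\<exists>l. \<forall>i<N. card {K \<in> interval X V (Suc a). T \<subseteq> K \<and> f K = i} = l"
      using f unfolding balanced_def by blast
    moreover have "{K \<in> interval X V (Suc a). T \<subseteq> K \<and> f K = i} = {K \<in> interval L V a. T \<subseteq> K \<and> f K = i}" for i
      using T L by (auto simp: interval_def)
    ultimately show "\<exists>l. \<forall>i<N. card {K \<in> interval L V a. T \<subseteq> K \<and> f K = i} = l"
      by (simp only:)
  qed
  moreover have "dim V = dim L + a + b" using X(5) L(4) by simp
  ultimately show ?thesis unfolding LS_def partitionable_def using L(1,3) X(2,3) by blast
qed

text \<open>Counts the pairs \<open>(x, K)\<close> with \<open>x\<close> in \<open>K - H\<close>.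
  For \<open>x\<close> outside \<open>H\<close>, the blocks through \<open>T\<close> and
  \<open>x\<close> are those through \<open>span (insert x T)\<close>, and they leave
  \<open>H\<close> automatically.\<close>

lemma card_blocks_not_subset:
  assumes "finite V" "finite \<B>" "\<And>K. K \<in> \<B> \<Longrightarrow> subspace K \<and> K \<subseteq> V"
    and "subspace T" "T \<subseteq> H" "\<And>K. K \<in> \<B> \<Longrightarrow> T \<subseteq> K \<Longrightarrow> \<not> K \<subseteq> H \<Longrightarrow> card (K - H) = c"
  shows "card {K\<in>\<B>. T \<subseteq> K \<and> \<not> K \<subseteq> H} * c = (\<Sum>x\<in>V - H. card {K\<in>\<B>. span (insert x T) \<subseteq> K})"
proof -
  have "(\<Sum>K\<in>{K\<in>\<B>. T \<subseteq> K \<and> \<not> K \<subseteq> H}. card (K - H))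
      = (\<Sum>x\<in>V - H. card {K\<in>{K\<in>\<B>. T \<subseteq> K \<and> \<not> K \<subseteq> H}. x \<in> K})"
    by (rule sum_card_Diff) (use assms in auto)
  also have "(\<Sum>K\<in>{K\<in>\<B>. T \<subseteq> K \<and> \<not> K \<subseteq> H}. card (K - H)) = card {K\<in>\<B>. T \<subseteq> K \<and> \<not> K \<subseteq> H} * c"
    using assms(6) by simp
  also have "(\<Sum>x\<in>V - H. card {K\<in>{K\<in>\<B>. T \<subseteq> K \<and> \<not> K \<subseteq> H}. x \<in> K})
      = (\<Sum>x\<in>V - H. card {K\<in>\<B>. span (insert x T) \<subseteq> K})"
  proof (rule sum.cong[OF refl])
    fix x assume "x \<in> V - H"
    moreover have "span (insert x T) \<subseteq> K \<longleftrightarrow> T \<subseteq> K \<and> x \<in> K" if "K \<in> \<B>" for K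
      using span_insert_subset_iff[OF assms(4)] assms(3)[OF that] by simp
    ultimately have "{K\<in>{K\<in>\<B>. T \<subseteq> K \<and> \<not> K \<subseteq> H}. x \<in> K} = {K\<in>\<B>. span (insert x T) \<subseteq> K}"
      by blast
    then show "card {K\<in>{K\<in>\<B>. T \<subseteq> K \<and> \<not> K \<subseteq> H}. x \<in> K} = card {K\<in>\<B>. span (insert x T) \<subseteq> K}"
      by simp
  qed
  finally show ?thesis .
qed

text \<open>The preceding count, applied to each colour class: uniformity for the spaces spanned by
  \<open>T\<close> and a point outside \<open>H\<close> passes down to \<open>T\<close>. It is used
  with \<open>H\<close> a hyperplane for residuals, and with \<open>H = T\<close> for lowering the
  dimension of test spaces.\<close>

lemma card_blocks_not_subset_const:
  assumes "finite V" "finite \<B>" "\<And>K. K \<in> \<B> \<Longrightarrow> subspace K \<and> K \<subseteq> V"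
    and "subspace T" "T \<subseteq> H" "\<And>K. K \<in> \<B> \<Longrightarrow> T \<subseteq> K \<Longrightarrow> \<not> K \<subseteq> H \<Longrightarrow> card (K - H) = c" "c > 0"
    and "\<And>x. x \<in> V - H \<Longrightarrow> \<exists>l. \<forall>i<N. card {K\<in>\<B>. span (insert x T) \<subseteq> K \<and> f K = i} = l"
  shows "\<exists>l. \<forall>i<N. card {K\<in>\<B>. T \<subseteq> K \<and> \<not> K \<subseteq> H \<and> f K = i} = l"
proof -
  have "\<forall>x\<in>V - H. \<exists>l. \<forall>i<N. card {K\<in>\<B>. span (insert x T) \<subseteq> K \<and> f K = i} = l"
    using assms(8) by (rule ballI)
  then obtain l where "\<forall>x\<in>V - H. \<forall>i<N. card {K\<in>\<B>. span (insert x T) \<subseteq> K \<and> f K = i} = l x"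
    by (rule bchoice[THEN exE])
  then have l: "card {K\<in>\<B>. span (insert x T) \<subseteq> K \<and> f K = i} = l x" if "x \<in> V - H" "i < N" for x i
    using that by blast
  have "card {K\<in>\<B>. T \<subseteq> K \<and> \<not> K \<subseteq> H \<and> f K = i} = (\<Sum>x\<in>V - H. l x) div c" if "i < N" for i
  proof -
    have "card {K\<in>{K\<in>\<B>. f K = i}. T \<subseteq> K \<and> \<not> K \<subseteq> H} * c
        = (\<Sum>x\<in>V - H. card {K\<in>{K\<in>\<B>. f K = i}. span (insert x T) \<subseteq> K})"
      by (rule card_blocks_not_subset[OF assms(1) _ _ assms(4,5)]) (use assms(2,3,6) in simp_all)
    moreover have "{K\<in>{K\<in>\<B>. f K = i}. T \<subseteq> K \<and> \<not> K \<subseteq> H} = {K\<in>\<B>. T \<subseteq> K \<and> \<not> K \<subseteq> H \<and> f K = i}"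
      by auto
    moreover have "{K\<in>{K\<in>\<B>. f K = i}. span (insert x T) \<subseteq> K} = {K\<in>\<B>. span (insert x T) \<subseteq> K \<and> f K = i}" for x
      by auto
    moreover have "(\<Sum>x\<in>V - H. card {K\<in>\<B>. span (insert x T) \<subseteq> K \<and> f K = i}) = (\<Sum>x\<in>V - H. l x)"
      using l that by (intro sum.cong) simp_all
    ultimately have "(\<Sum>x\<in>V - H. l x) = card {K\<in>\<B>. T \<subseteq> K \<and> \<not> K \<subseteq> H \<and> f K = i} * c"
      by (simp only:)
    then show ?thesis using assms(7) by (simp only: div_mult_self_is_m)
  qed
  then show ?thesis by blast
qed

text \<open>Keep the colouring on the blocks inside a hyperplane \<open>H\<close> containing
  \<open>X\<close>. The blocks through \<open>T\<close> that leave \<open>H\<close> are uniformly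
  coloured, because adjoining a point to \<open>T\<close> raises its dimension by only one;
  subtracting them from all blocks through \<open>T\<close> leaves those inside
  \<open>H\<close>.\<close>

lemma LS_residual:
  assumes "LS N a (Suc b) (Suc s)"
  shows "LS N a b s"
proof -
  obtain X V f where X: "subspace X" "subspace V" "finite V" "X \<subseteq> V" "dim V = dim X + a + Suc b"
    and f: "balanced N (Suc s) X V (interval X V a) f"
    using assms(1) unfolding LS_def partitionable_def by blast
  obtain H where H: "subspace H" "X \<subseteq> H" "H \<subseteq> V" "dim H = dim X + a + b"
    using intermediate_subspace[of X V "dim X + a + b"] X by auto
  let ?I = "interval X V a"
  have finH: "finite H" using X(3) H(3) by (rule rev_finite_subset)
  have fI: "finite ?I" by (rule finite_interval[OF X(3)])
  have sub: "\<And>K. K \<in> ?I \<Longrightarrow> subspace K \<and> K \<subseteq> V" by (auto simp: interval_def)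
  \<comment> \<open>A block not contained in the hyperplane \<open>H\<close> meets it in codimension
    one, so \<open>?c\<close> is the number of its points outside \<open>H\<close>.\<close>
  let ?c = "CARD('a) ^ (dim X + a) - CARD('a) ^ (dim X + a - 1)"
  have c: "card (K - H) = ?c" "?c > 0" if "K \<in> ?I" "\<not> K \<subseteq> H" for K
  proof -
    have K: "subspace K" "K \<subseteq> V" "X \<subseteq> K" "dim K = dim X + a" using that by (auto simp: interval_def)
    have fK: "finite K" using X(3) K(2) by (rule rev_finite_subset)
    have sKH: "subspace (K + H)" "K + H \<subseteq> V" using K H X subspace_set_plus sums_least by auto
    have "H \<noteq> K + H" using that sums_upper1 H by blast
    then have "\<not> dim (K + H) \<le> dim H"
      using dim_eq_imp_eq[of H "K + H"] H K sKH X sums_upper2 finite_set_plus fK finH by blast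
    moreover have "dim (K + H) + dim (K \<inter> H) = dim K + dim H"
      by (rule dim_sums_Int_fin) (use K H fK finH in auto)
    moreover have "dim (K + H) \<le> dim V" using dim_mono_fin sKH X by blast
    ultimately have d: "dim (K \<inter> H) = dim X + a - 1" "dim X + a > 0" using K H X by auto
    have "card (K - H) = card K - card (K \<inter> H)"
      using card_Diff_subset[of "K \<inter> H" K] fK by (simp add: Diff_Int)
    then show "card (K - H) = ?c"
      using card_subspace K H fK subspace_inter d by simp
    show "?c > 0" using d q_gt_1 by simp
  qed
  have "balanced N s X H (interval X H a) f"
    unfolding balanced_def
  proof (intro conjI ballI allI impI)
    fix K assume "K \<in> interval X H a"
    then have "K \<in> ?I" using H by (auto simp: interval_def)
    then show "f K < N" using f by (auto simp: balanced_def)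
  next
    fix T assume T: "subspace T \<and> X \<subseteq> T \<and> T \<subseteq> H \<and> dim T < dim X + s"
    have finT: "finite T" using finH T by (auto intro: rev_finite_subset)
    have bal: "\<exists>l. \<forall>i<N. card {K \<in> ?I. T' \<subseteq> K \<and> f K = i} = l"
      if "subspace T'" "X \<subseteq> T'" "T' \<subseteq> V" "dim T' < dim X + Suc s" for T'
      using f that unfolding balanced_def by blast
    have "\<exists>l. \<forall>i<N. card {K \<in> ?I. T \<subseteq> K \<and> \<not> K \<subseteq> H \<and> f K = i} = l"
    \<comment> \<open>\<open>?c\<close> is known to be positive only if some block leaves
      \<open>H\<close>; otherwise the set to be counted is empty for every colour.\<close>
    proof (cases "\<exists>K\<in>?I. \<not> K \<subseteq> H")
      case True
      then have "?c > 0" using c(2) by blast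
      moreover have "\<exists>l. \<forall>i<N. card {K\<in>?I. span (insert x T) \<subseteq> K \<and> f K = i} = l" if x: "x \<in> V - H" for x
      proof (rule bal)
        have "x \<notin> T" using x T by blast
        show "X \<subseteq> span (insert x T)" using T span_superset by blast
        show "span (insert x T) \<subseteq> V" using span_insert_subset_iff[of T V x] T x X H by blast
        show "dim (span (insert x T)) < dim X + Suc s" using adjoin(2)[of T x] T finT \<open>x \<notin> T\<close> by auto
      qed simp
      ultimately show ?thesis
        using T by (intro card_blocks_not_subset_const[OF X(3) fI sub _ _ c(1)]) blast+
    next
      case False
      then have e: "{K \<in> ?I. T \<subseteq> K \<and> \<not> K \<subseteq> H \<and> f K = i} = {}" for i by blast
      show ?thesis by (simp only: e) blast
    qed
    then obtain l where l: "\<forall>i<N. card {K \<in> ?I. T \<subseteq> K \<and> \<not> K \<subseteq> H \<and> f K = i} = l" by blast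
    have "T \<subseteq> V" using T H by blast
    then obtain m where m: "\<forall>i<N. card {K \<in> ?I. T \<subseteq> K \<and> f K = i} = m"
      using bal[of T] T by auto
    have "card {K \<in> interval X H a. T \<subseteq> K \<and> f K = i} = m - l" if "i < N" for i
    proof -
      let ?A = "{K \<in> ?I. T \<subseteq> K \<and> f K = i}" and ?B = "{K \<in> ?I. T \<subseteq> K \<and> \<not> K \<subseteq> H \<and> f K = i}"
      have "{K \<in> interval X H a. T \<subseteq> K \<and> f K = i} = ?A - ?B"
        using H by (auto simp: interval_def)
      moreover have "card (?A - ?B) = card ?A - card ?B"
        using fI by (intro card_Diff_subset) auto
      ultimately show ?thesis using l m that by simp
    qed
    then show "\<exists>l. \<forall>i<N. card {K \<in> interval X H a. T \<subseteq> K \<and> f K = i} = l" by blast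
  qed
  then show ?thesis unfolding LS_def partitionable_def
    using H X finH by (intro exI[of _ X] exI[of _ H]) auto
qed

lemma LS_derived_iter: "LS N a b s \<Longrightarrow> i \<le> a \<Longrightarrow> i \<le> s \<Longrightarrow> LS N (a - i) b (s - i)"
proof (induction i)
  case (Suc i)
  then have "LS N (Suc (a - Suc i)) b (Suc (s - Suc i))" by (simp add: Suc_diff_Suc)
  then show ?case by (rule LS_derived)
qed simp

lemma LS_residual_iter: "LS N a b s \<Longrightarrow> i \<le> b \<Longrightarrow> i \<le> s \<Longrightarrow> LS N a (b - i) (s - i)"
proof (induction i)
  case (Suc i)
  then have "LS N a (Suc (b - Suc i)) (Suc (s - Suc i))" by (simp add: Suc_diff_Suc)
  then show ?case by (rule LS_residual)
qed simp

text \<open>A design constrains only \<open>t\<close>-dimensional \<open>T\<close>; this lemma supplies the smaller ones.\<close>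

lemma balanced_downward:
  assumes V: "subspace V" "finite V" "t \<le> k" "k \<le> dim V"
    and lt: "\<forall>K\<in>interval {0} V k. f K < N"
    and bal: "\<And>T. T \<in> interval {0} V t \<Longrightarrow>
      \<exists>l. \<forall>i<N. card {K\<in>interval {0} V k. T \<subseteq> K \<and> f K = i} = l"
  shows "balanced N (Suc t) {0} V (interval {0} V k) f"
proof -
  let ?I = "interval {0} V k"
  have "\<exists>l. \<forall>i<N. card {K\<in>?I. T \<subseteq> K \<and> f K = i} = l" if "u \<le> t" "T \<in> interval {0} V u" for u T
    using that
  proof (induction arbitrary: T rule: inc_induct)
    case base then show ?case by (rule bal)
  next
    case (step u)
    then have T: "subspace T" "T \<subseteq> V" "dim T = u" by (auto simp: interval_def dim_zero)
    have fT: "finite T" using V(2) T(2) by (rule rev_finite_subset)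
    have u: "u < k" using step.hyps V by simp
    have ext: "\<exists>l. \<forall>i<N. card {K\<in>?I. span (insert x T) \<subseteq> K \<and> f K = i} = l" if "x \<in> V - T" for x
    proof (rule step.IH)
      show "span (insert x T) \<in> interval {0} V (Suc u)"
        using T that fT adjoin(2)[of T x] V span_insert_subset_iff[of T V x]
        by (auto simp: interval_def dim_zero span_zero)
    qed
    have "\<exists>l. \<forall>i<N. card {K\<in>?I. T \<subseteq> K \<and> \<not> K \<subseteq> T \<and> f K = i} = l"
    proof (rule card_blocks_not_subset_const[OF V(2) finite_interval[OF V(2)] _ T(1) subset_refl _ _ ext])
      show "card (K - T) = CARD('a) ^ k - CARD('a) ^ u" if "K \<in> ?I" "T \<subseteq> K" for K
      proof -
        have K: "subspace K" "K \<subseteq> V" "dim K = k" using that by (auto simp: interval_def dim_zero)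
        have "finite K" using V(2) K(2) by (rule rev_finite_subset)
        then show ?thesis using that(2) T K fT card_subspace by (simp add: card_Diff_subset)
      qed
      show "0 < CARD('a) ^ k - CARD('a) ^ u" using u q_gt_1 by simp
    qed (auto simp: interval_def)
    moreover have "\<not> K \<subseteq> T" if "K \<in> ?I" for K
      using that dim_mono_fin[of K T] T fT u by (auto simp: interval_def dim_zero)
    then have "{K\<in>?I. T \<subseteq> K \<and> \<not> K \<subseteq> T \<and> f K = i} = {K\<in>?I. T \<subseteq> K \<and> f K = i}" for i by blast
    ultimately show ?case by simp
  qed
  note * = this
  show ?thesis unfolding balanced_def
  proof (intro conjI allI impI)
    fix T assume T: "subspace T \<and> {0} \<subseteq> T \<and> T \<subseteq> V \<and> dim T < dim {0} + Suc t"
    then have "dim T \<le> t" "T \<in> interval {0} V (dim T)" by (auto simp: dim_zero interval_def)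
    then show "\<exists>l. \<forall>i<N. card {K\<in>?I. T \<subseteq> K \<and> f K = i} = l" by (rule *)
  qed (rule lt)
qed

subsection \<open>Joins and decompositions along a flag\<close>

text \<open>The spaces \<open>K\<close> through \<open>T\<close> are grouped by the pair
  \<open>(K \<inter> X, K + X)\<close>; all groups have the same size by
  \<open>card_join_fibre\<close>, so counting colours reduces to counting pairs. The families \<A>
  and \<C> may be proper parts of the intervals, which lets the lower space be smaller and the upper
  space larger than \<open>X\<close>.\<close>

lemma partitionable_join:
  assumes X: "subspace X" "X \<subseteq> V" and V: "subspace V" "finite V"
    and \<A>: "\<A> \<subseteq> interval {0} X c" "partitionable N s1 {0} X \<A>"
    and \<C>: "\<C> \<subseteq> interval X V d" "partitionable N s2 X V \<C>"
  shows "partitionable N (s1 + s2) {0} V {K. subspace K \<and> K \<inter> X \<in> \<A> \<and> K + X \<in> \<C>}"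
proof -
  let ?J = "{K. subspace K \<and> K \<inter> X \<in> \<A> \<and> K + X \<in> \<C>}"
  obtain f1 f2 where f: "balanced N s1 {0} X \<A> f1" "balanced N s2 X V \<C> f2"
    using \<A>(2) \<C>(2) unfolding partitionable_def by blast
  have fX: "finite X" using V(2) X(2) by (rule rev_finite_subset)
  have fin: "finite \<A>" "finite \<C>"
    using \<A>(1) \<C>(1) finite_interval fX V(2) by (auto intro: finite_subset)
  define f where "f K = (f1 (K \<inter> X) + f2 (K + X)) mod N" for K
  have f1N: "f1 K < N" if "K \<in> \<A>" for K using f(1) that by (simp add: balanced_def)
  have f2N: "f2 K < N" if "K \<in> \<C>" for K using f(2) that by (simp add: balanced_def)
  have A: "subspace K" "K \<subseteq> X" "dim K = c" if "K \<in> \<A>" for K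
    using that \<A>(1) by (auto simp: interval_def dim_zero)
  have C: "subspace K" "X \<subseteq> K" "K \<subseteq> V" "dim K = dim X + d" if "K \<in> \<C>" for K
    using that \<C>(1) by (auto simp: interval_def)
  have JV: "K \<subseteq> V" if "K \<in> ?J" for K
  proof -
    have "K \<subseteq> K + X" using sums_upper1 X by blast
    then show ?thesis using that C(3) by blast
  qed
  have "balanced N (s1 + s2) {0} V ?J f"
    unfolding balanced_def
  proof (intro conjI ballI allI impI)
    fix K assume "K \<in> ?J"
    then have "f1 (K \<inter> X) < N" using f1N by blast
    then show "f K < N" by (simp add: f_def)
  next
    fix T assume T: "subspace T \<and> {0} \<subseteq> T \<and> T \<subseteq> V \<and> dim T < dim {0} + (s1 + s2)"
    have fT: "finite T" using V(2) T by (auto intro: rev_finite_subset)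
    have sT: "subspace (T \<inter> X)" "subspace (T + X)" "T + X \<subseteq> V"
      using T X V subspace_inter subspace_set_plus sums_least by auto
    have XT: "X \<subseteq> T + X" using T sums_upper2 by blast
    let ?A = "{K\<in>\<A>. T \<inter> X \<subseteq> K}" and ?C = "{K\<in>\<C>. T + X \<subseteq> K}"
    \<comment> \<open>The common size of the groups. It may depend on \<open>T\<close>, but not on
      the pair or the colour.\<close>
    define r where "r = CARD('a) ^ ((dim X - c) * (dim X + d - dim (T + X)))"
    have cnt: "card {K\<in>?J. T \<subseteq> K \<and> f K = i}
        = r * card {p \<in> ?A \<times> ?C. (f1 (fst p) + f2 (snd p)) mod N = i}" for i
    proof -
      let ?P = "{p \<in> ?A \<times> ?C. (f1 (fst p) + f2 (snd p)) mod N = i}"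
      let ?G = "\<lambda>p. {K. subspace K \<and> T \<subseteq> K \<and> K \<inter> X = fst p \<and> K + X = snd p}"
      have "{K\<in>?J. T \<subseteq> K \<and> f K = i} = (\<Union>p\<in>?P. ?G p)"
      proof (intro equalityI subsetI)
        fix K assume K: "K \<in> {K\<in>?J. T \<subseteq> K \<and> f K = i}"
        then have "T + X \<subseteq> K + X" by (intro sums_mono) auto
        then have "(K \<inter> X, K + X) \<in> ?P" using K by (auto simp: f_def)
        moreover have "K \<in> ?G (K \<inter> X, K + X)" using K by simp
        ultimately show "K \<in> (\<Union>p\<in>?P. ?G p)" by blast
      qed (auto simp: f_def)
      moreover have "card (\<Union>p\<in>?P. ?G p) = (\<Sum>p\<in>?P. card (?G p))"
      proof (rule card_UN_disjoint)
        show "finite ?P" using fin by (auto intro: finite_subset[of _ "\<A> \<times> \<C>"])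
        show "\<forall>p\<in>?P. finite (?G p)"
        proof
          fix p assume "p \<in> ?P"
          then have "?G p \<subseteq> ?J" by auto
          then have "?G p \<subseteq> Pow V" using JV by blast
          then show "finite (?G p)" using V(2) by (auto intro: finite_subset)
        qed
      qed (auto simp: prod_eq_iff)
      moreover have "card (?G p) = r" if "p \<in> ?P" for p
      proof -
        have p: "fst p \<in> \<A>" "T \<inter> X \<subseteq> fst p" "snd p \<in> \<C>" "T + X \<subseteq> snd p" using that by auto
        have "card (?G p) = CARD('a) ^ ((dim X - dim (fst p)) * (dim (snd p) - dim (T + X)))"
          using T p A[OF p(1)] C[OF p(3)] X V by (intro card_join_fibre) simp_all
        then show ?thesis using A(3)[OF p(1)] C(4)[OF p(3)] by (simp add: r_def)
      qed
      ultimately show ?thesis by simp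
    qed
    have "dim (T + X) + dim (T \<inter> X) = dim T + dim X"
      by (rule dim_sums_Int_fin) (use T X fT fX in auto)
    \<comment> \<open>The dimension of \<open>T \<inter> X\<close> and the rank of
      \<open>T + X\<close> over \<open>X\<close> add up to \<open>dim T < s1 + s2\<close>, so one of
      them is below its bound and the colouring on that side is uniform.\<close>
    then consider "dim (T \<inter> X) < s1" | "dim (T + X) < dim X + s2"
      using T dim_zero by linarith
    then show "\<exists>l. \<forall>i<N. card {K\<in>?J. T \<subseteq> K \<and> f K = i} = l"
    proof cases
      case 1
      then have "subspace (T \<inter> X) \<and> {0} \<subseteq> T \<inter> X \<and> T \<inter> X \<subseteq> X \<and> dim (T \<inter> X) < dim {0} + s1"
        using sT subspace_0[OF sT(1)] dim_zero by auto
      then obtain l where l: "\<forall>i<N. card {K\<in>\<A>. T \<inter> X \<subseteq> K \<and> f1 K = i} = l"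
        using f(1) unfolding balanced_def by blast
      moreover have "{K\<in>?A. f1 K = i} = {K\<in>\<A>. T \<inter> X \<subseteq> K \<and> f1 K = i}" for i by auto
      ultimately have l': "card {K\<in>?A. f1 K = i} = l" if "i < N" for i using that by simp
      have "card {p \<in> ?A \<times> ?C. (f1 (fst p) + f2 (snd p)) mod N = i} = l * card ?C" if "i < N" for i
        by (rule card_pairs_sum_mod) (use fin f1N f2N l' that in auto)
      then show ?thesis using cnt by simp
    next
      case 2
      then obtain l where l: "\<forall>i<N. card {K\<in>\<C>. T + X \<subseteq> K \<and> f2 K = i} = l"
        using f(2) sT XT unfolding balanced_def by blast
      moreover have "{K\<in>?C. f2 K = i} = {K\<in>\<C>. T + X \<subseteq> K \<and> f2 K = i}" for i by auto
      ultimately have l': "card {K\<in>?C. f2 K = i} = l" if "i < N" for i using that by simp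
      have "card {p \<in> ?A \<times> ?C. (f1 (fst p) + f2 (snd p)) mod N = i} = l * card ?A" if "i < N" for i
      proof -
        have "card {p \<in> ?C \<times> ?A. (f2 (fst p) + f1 (snd p)) mod N = i} = l * card ?A"
          by (rule card_pairs_sum_mod) (use fin f1N f2N l' that in auto)
        moreover have "{p \<in> ?A \<times> ?C. (f1 (fst p) + f2 (snd p)) mod N = i}
            = prod.swap ` {p \<in> ?C \<times> ?A. (f2 (fst p) + f1 (snd p)) mod N = i}"
          by (force simp: add.commute)
        ultimately show ?thesis by (simp add: card_image)
      qed
      then show ?thesis using cnt by simp
    qed
  qed
  then show ?thesis unfolding partitionable_def by blast
qed

text \<open>A new test space, one not contained in \<open>U\<close>, lies in no block, so all its
  counts are zero.\<close>

lemma partitionable_enlarge_top: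
  assumes "partitionable N s X U \<B>" "\<And>K. K \<in> \<B> \<Longrightarrow> K \<subseteq> U"
  shows "partitionable N s X V \<B>"
proof -
  obtain f where f: "balanced N s X U \<B> f" using assms(1) unfolding partitionable_def by blast
  have "balanced N s X V \<B> f"
    unfolding balanced_def
  proof (intro conjI allI impI)
    show "\<forall>K\<in>\<B>. f K < N" using f by (simp add: balanced_def)
    fix T assume T: "subspace T \<and> X \<subseteq> T \<and> T \<subseteq> V \<and> dim T < dim X + s"
    show "\<exists>l. \<forall>i<N. card {K\<in>\<B>. T \<subseteq> K \<and> f K = i} = l"
    proof (cases "T \<subseteq> U")
      case True
      then show ?thesis using f T unfolding balanced_def by blast
    next
      case False
      then have e: "{K\<in>\<B>. T \<subseteq> K \<and> f K = i} = {}" for i using assms(2) by blast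
      show ?thesis by (simp only: e) blast
    qed
  qed
  then show ?thesis unfolding partitionable_def by blast
qed

text \<open>All blocks contain \<open>W\<close>, so \<open>T\<close> and \<open>T + W\<close> lie in
  the same blocks. The rank of \<open>T + W\<close> over \<open>W\<close> is at most the rank of
  \<open>T\<close> over \<open>U\<close>, because \<open>U \<subseteq> T \<inter> W\<close>.\<close>

lemma partitionable_enlarge_bottom:
  assumes "partitionable N s W V \<B>" "\<And>K. K \<in> \<B> \<Longrightarrow> subspace K \<and> W \<subseteq> K"
    and U: "subspace U" "U \<subseteq> W" and W: "subspace W" "W \<subseteq> V" and V: "subspace V" "finite V"
  shows "partitionable N s U V \<B>"
proof -
  obtain f where f: "balanced N s W V \<B> f" using assms(1) unfolding partitionable_def by blast
  have "balanced N s U V \<B> f"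
    unfolding balanced_def
  proof (intro conjI allI impI)
    show "\<forall>K\<in>\<B>. f K < N" using f by (simp add: balanced_def)
    fix T assume T: "subspace T \<and> U \<subseteq> T \<and> T \<subseteq> V \<and> dim T < dim U + s"
    have fin: "finite T" "finite W" using T W(2) V(2) rev_finite_subset[of V] by blast+
    have "subspace (T \<inter> W)" using T W subspace_inter by blast
    then have "dim U \<le> dim (T \<inter> W)" using U T fin by (intro dim_mono_fin) auto
    moreover have "dim (T + W) + dim (T \<inter> W) = dim T + dim W"
      by (rule dim_sums_Int_fin) (use T W fin in auto)
    ultimately have "dim (T + W) < dim W + s" using T by linarith
    moreover have "subspace (T + W)" using T W(1) by (simp add: subspace_set_plus)
    moreover have "W \<subseteq> T + W" using T by (simp add: sums_upper2)
    moreover have "T + W \<subseteq> V" using T W(2) V(1) by (simp add: sums_least)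
    ultimately have "\<exists>l. \<forall>i<N. card {K\<in>\<B>. T + W \<subseteq> K \<and> f K = i} = l"
      using f unfolding balanced_def by blast
    moreover have iff: "T + W \<subseteq> K \<longleftrightarrow> T \<subseteq> K" if "K \<in> \<B>" for K
    proof
      assume "T + W \<subseteq> K"
      then show "T \<subseteq> K" using sums_upper1[OF W(1), of T] by blast
    next
      assume "T \<subseteq> K"
      then show "T + W \<subseteq> K" using assms(2)[OF that] by (simp add: sums_least)
    qed
    have "{K\<in>\<B>. T + W \<subseteq> K \<and> f K = i} = {K\<in>\<B>. T \<subseteq> K \<and> f K = i}" for i using iff by blast
    ultimately show "\<exists>l. \<forall>i<N. card {K\<in>\<B>. T \<subseteq> K \<and> f K = i} = l" by (simp only:)
  qed
  then show ?thesis unfolding partitionable_def by blast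
qed

lemma partitionable_disjoint_union:
  assumes "finite I" "\<And>i. i \<in> I \<Longrightarrow> finite (\<B> i)" "\<And>i. i \<in> I \<Longrightarrow> partitionable N s X V (\<B> i)"
    and u: "\<And>K. K \<in> \<D> \<Longrightarrow> \<exists>!i. i \<in> I \<and> K \<in> \<B> i" and sub: "\<And>i. i \<in> I \<Longrightarrow> \<B> i \<subseteq> \<D>"
  shows "partitionable N s X V \<D>"
proof -
  have "\<forall>i\<in>I. \<exists>f. balanced N s X V (\<B> i) f"
    using assms(3) unfolding partitionable_def by blast
  then obtain f where f: "\<forall>i\<in>I. balanced N s X V (\<B> i) (f i)"
    by (rule bchoice[THEN exE])
  define idx where "idx K = (THE i. i \<in> I \<and> K \<in> \<B> i)" for K
  have idx: "idx K = i" if "i \<in> I" "K \<in> \<B> i" for K i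
    unfolding idx_def using that u sub by (intro the1_equality) blast+
  define g where "g K = f (idx K) K" for K
  have "balanced N s X V \<D> g"
    unfolding balanced_def
  proof (intro conjI ballI allI impI)
    fix K assume "K \<in> \<D>"
    then obtain i where "i \<in> I" "K \<in> \<B> i" using u by blast
    then show "g K < N" using f idx by (simp add: balanced_def g_def)
  next
    fix T assume T: "subspace T \<and> X \<subseteq> T \<and> T \<subseteq> V \<and> dim T < dim X + s"
    then have "\<forall>i\<in>I. \<exists>l. \<forall>m<N. card {K\<in>\<B> i. T \<subseteq> K \<and> f i K = m} = l"
      using f unfolding balanced_def by blast
    then obtain l where l: "\<forall>i\<in>I. \<forall>m<N. card {K\<in>\<B> i. T \<subseteq> K \<and> f i K = m} = l i"
      by (rule bchoice[THEN exE])
    have "card {K\<in>\<D>. T \<subseteq> K \<and> g K = m} = sum l I" if "m < N" for m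
    proof -
      have "{K\<in>\<D>. T \<subseteq> K \<and> g K = m} = (\<Union>i\<in>I. {K\<in>\<B> i. T \<subseteq> K \<and> f i K = m})"
      proof (intro equalityI subsetI)
        fix K assume K: "K \<in> {K\<in>\<D>. T \<subseteq> K \<and> g K = m}"
        then obtain i where i: "i \<in> I" "K \<in> \<B> i" using u by blast
        then show "K \<in> (\<Union>i\<in>I. {K\<in>\<B> i. T \<subseteq> K \<and> f i K = m})"
          using K idx[OF i] by (auto simp: g_def)
      next
        fix K assume "K \<in> (\<Union>i\<in>I. {K\<in>\<B> i. T \<subseteq> K \<and> f i K = m})"
        then obtain i where i: "i \<in> I" "K \<in> \<B> i" "T \<subseteq> K" "f i K = m" by blast
        then show "K \<in> {K\<in>\<D>. T \<subseteq> K \<and> g K = m}" using idx[OF i(1,2)] sub by (auto simp: g_def)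
      qed
      also have "card \<dots> = (\<Sum>i\<in>I. card {K\<in>\<B> i. T \<subseteq> K \<and> f i K = m})"
      proof (rule card_UN_disjoint)
        show "\<forall>i\<in>I. \<forall>j\<in>I. i \<noteq> j \<longrightarrow>
          {K\<in>\<B> i. T \<subseteq> K \<and> f i K = m} \<inter> {K\<in>\<B> j. T \<subseteq> K \<and> f j K = m} = {}"
        proof (intro ballI impI equals0I)
          fix i j K assume "i \<in> I" "j \<in> I" "i \<noteq> j"
            "K \<in> {K\<in>\<B> i. T \<subseteq> K \<and> f i K = m} \<inter> {K\<in>\<B> j. T \<subseteq> K \<and> f j K = m}"
          then show False using idx[of i K] idx[of j K] by simp
        qed
      qed (use assms(1,2) in auto)
      also have "\<dots> = sum l I" using l that by (intro sum.cong) auto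
      finally show ?thesis .
    qed
    then show "\<exists>l. \<forall>m<N. card {K\<in>\<D>. T \<subseteq> K \<and> g K = m} = l" by blast
  qed
  then show ?thesis unfolding partitionable_def by blast
qed

text \<open>Common frame for both flag decompositions. Part \<open>i\<close> is a join across
  \<open>X i\<close> with the restrictions \<open>K \<inter> X i \<subseteq> U i\<close> and
  \<open>W i \<subseteq> K + X i\<close>; the last equation in \<open>dim\<close> is the dimension
  formula for \<open>K\<close> and \<open>X i\<close>. \<open>LS_cover\<close> uses
  \<open>X i = U i\<close> and \<open>LS_avoid\<close> uses \<open>X i = W i\<close>.\<close>

lemma LS_decomposition:
  fixes n :: nat
  assumes V: "subspace V" "finite V" "dim V = k + b"
    and U: "\<And>i. i \<le> n \<Longrightarrow> subspace (U i) \<and> subspace (X i) \<and> subspace (W i) \<and>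
      U i \<subseteq> X i \<and> X i \<subseteq> W i \<and> W i \<subseteq> V"
    and dim: "\<And>i. i \<le> n \<Longrightarrow> dim (U i) = a i + c i \<and> dim V = dim (W i) + d i + e i \<and>
      k + dim (X i) = a i + dim (W i) + d i"
    and LS: "\<And>i. i \<le> n \<Longrightarrow> \<exists>s1 s2. s1 + s2 = s \<and> LS N (a i) (c i) s1 \<and> LS N (d i) (e i) s2"
    and cover: "\<And>K. K \<in> interval {0} V k \<Longrightarrow>
      \<exists>!i. i \<le> n \<and> K \<inter> X i \<in> interval {0} (U i) (a i) \<and> K + X i \<in> interval (W i) V (d i)"
  shows "LS N k b s"
proof -
  let ?J = "\<lambda>i. {K. subspace K \<and> K \<inter> X i \<in> interval {0} (U i) (a i) \<and> K + X i \<in> interval (W i) V (d i)}"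
  have sub: "?J i \<subseteq> interval {0} V k" if i: "i \<le> n" for i
  proof
    fix K assume K: "K \<in> ?J i"
    have KV: "K \<subseteq> V" using K sums_upper1[of "X i" K] U[OF i] by (auto simp: interval_def)
    have XV: "X i \<subseteq> V" using U[OF i] by blast
    have "dim (K + X i) + dim (K \<inter> X i) = dim K + dim (X i)"
      by (rule dim_sums_Int_fin) (use K U[OF i] rev_finite_subset[OF V(2)] KV XV in auto)
    then have "dim K = k" using K dim[OF i] by (auto simp: interval_def dim_zero)
    then show "K \<in> interval {0} V k" using K KV subspace_0 by (auto simp: interval_def dim_zero)
  qed
  have part: "partitionable N s {0} V (?J i)" if i: "i \<le> n" for i
  proof -
    obtain s1 s2 where s: "s1 + s2 = s" "LS N (a i) (c i) s1" "LS N (d i) (e i) s2"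
      using LS[OF i] by blast
    have h: "subspace (U i)" "subspace (X i)" "subspace (W i)" "U i \<subseteq> X i" "X i \<subseteq> W i" "W i \<subseteq> V"
      "X i \<subseteq> V" "U i \<subseteq> V"
      using U[OF i] by auto
    have fU: "finite (U i)" using V(2) h(8) by (rule rev_finite_subset)
    have "partitionable N (s1 + s2) {0} V (?J i)"
    proof (rule partitionable_join[OF h(2,7) V(1,2)])
      show "interval {0} (U i) (a i) \<subseteq> interval {0} (X i) (a i)"
        using h(4) by (auto simp: interval_def)
      have "partitionable N s1 {0} (U i) (interval {0} (U i) (a i))"
        by (rule LS_imp_partitionable[OF s(2) subspace_single_0 h(1) fU])
          (use h(1) subspace_0 dim[OF i] dim_zero in auto)
      then show "partitionable N s1 {0} (X i) (interval {0} (U i) (a i))"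
        by (rule partitionable_enlarge_top) (simp add: interval_def)
      show "interval (W i) V (d i) \<subseteq> interval (X i) V (dim (W i) - dim (X i) + d i)"
        using h(5) dim_mono_fin[OF h(2,3) rev_finite_subset[OF V(2) h(6)] h(5)]
        by (auto simp: interval_def)
      have "partitionable N s2 (W i) V (interval (W i) V (d i))"
        by (rule LS_imp_partitionable[OF s(3) h(3) V(1,2) h(6)]) (use dim[OF i] in auto)
      then show "partitionable N s2 (X i) V (interval (W i) V (d i))"
        by (rule partitionable_enlarge_bottom)
          (use h V in \<open>simp_all add: interval_def\<close>)
    qed
    then show ?thesis using s(1) by simp
  qed
  have "partitionable N s {0} V (interval {0} V k)"
  proof (rule partitionable_disjoint_union[of "{..n}" ?J])
    show "finite (?J i)" if "i \<in> {..n}" for i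
      using sub[of i] that finite_interval[OF V(2)] by (auto intro: finite_subset)
    show "\<exists>!i. i \<in> {..n} \<and> K \<in> ?J i" if K: "K \<in> interval {0} V k" for K
    proof -
      have "subspace K" using K by (simp add: interval_def)
      then show ?thesis using cover[OF K] by simp
    qed
  qed (use part sub in auto)
  moreover have "{0} \<subseteq> V" using V(1) subspace_0 by blast
  moreover have "dim V = dim {0} + k + b" using V(3) dim_zero by simp
  ultimately show ?thesis using V(1,2) subspace_single_0 unfolding LS_def by blast
qed

section \<open>Position of a subspace relative to a full flag\<close>

lemma flag_dim_Int:
  assumes K: "subspace K" and U: "subspace U" "subspace W" "finite W" "U \<subseteq> W" "dim W = Suc (dim U)"
  shows "dim (K \<inter> U) \<le> dim (K \<inter> W)" "dim (K \<inter> W) \<le> Suc (dim (K \<inter> U))"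
proof -
  have s: "subspace (K \<inter> U)" "subspace (K \<inter> W)" using K U subspace_inter by auto
  have fU: "finite U" using U(3,4) by (rule rev_finite_subset)
  show "dim (K \<inter> U) \<le> dim (K \<inter> W)" using s U by (intro dim_mono_fin) auto
  have "dim (K \<inter> W + U) + dim (K \<inter> W \<inter> U) = dim (K \<inter> W) + dim U"
    by (rule dim_sums_Int_fin) (use s U fU in auto)
  moreover have "K \<inter> W \<inter> U = K \<inter> U" using U by blast
  moreover have "dim (K \<inter> W + U) \<le> dim W"
    using s U by (intro dim_mono_fin subspace_set_plus sums_least) auto
  ultimately show "dim (K \<inter> W) \<le> Suc (dim (K \<inter> U))" using U by simp
qed

text \<open>By the dimension formula, exactly one of \<open>K \<inter> U\<close> and
  \<open>K + U\<close> grows when \<open>U\<close> is enlarged to \<open>W\<close>. This translates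
  the condition \<open>W \<subseteq> K + U\<close> on the parts of \<open>LS_cover\<close> into a
  step of the intersection dimension.\<close>

lemma subset_sum_iff:
  assumes K: "subspace K" "finite K"
    and U: "subspace U" "subspace W" "finite W" "U \<subseteq> W" "dim W = Suc (dim U)"
  shows "W \<subseteq> K + U \<longleftrightarrow> dim (K \<inter> W) = Suc (dim (K \<inter> U))"
proof -
  have fU: "finite U" using U(3,4) by (rule rev_finite_subset)
  have d: "dim (K + U) + dim (K \<inter> U) = dim K + dim U" "dim (K + W) + dim (K \<inter> W) = dim K + dim W"
    using dim_sums_Int_fin K U fU by auto
  have s: "subspace (K + U)" "subspace (K + W)" "finite (K + W)"
    using K U subspace_set_plus finite_set_plus by auto
  have le: "K + U \<subseteq> K + W" using U by (intro sums_mono) auto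
  have "W \<subseteq> K + U \<longleftrightarrow> K + U = K + W"
  proof
    assume "W \<subseteq> K + U"
    then have "K + W \<subseteq> K + U" using s sums_upper1[OF U(1), of K] by (intro sums_least) auto
    then show "K + U = K + W" using le by blast
  next
    assume "K + U = K + W"
    then show "W \<subseteq> K + U" using sums_upper2[OF K(1), of W] by blast
  qed
  also have "\<dots> \<longleftrightarrow> dim (K + U) = dim (K + W)" using dim_eq_imp_eq[OF s le] by auto
  also have "\<dots> \<longleftrightarrow> dim (K \<inter> W) = Suc (dim (K \<inter> U))" using d U(5) by linarith
  finally show ?thesis .
qed

lemma flag_crossing:
  assumes "finite V" "subspace V" "dim V = v" "K \<in> interval {0} V k"
    and F: "\<And>i. i \<le> v \<Longrightarrow> subspace (F i) \<and> F i \<subseteq> V \<and> dim (F i) = i"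
      "\<And>i. i < v \<Longrightarrow> F i \<subseteq> F (Suc i)"
  shows "a < k \<Longrightarrow> \<exists>!i. i \<le> v - k \<and> dim (K \<inter> F (a + i)) = a \<and> dim (K \<inter> F (Suc (a + i))) = Suc a"
    and "a < v - k \<Longrightarrow> \<exists>!i. i \<le> k \<and> dim (K \<inter> F (a + i)) = i \<and> dim (K \<inter> F (Suc (a + i))) = i"
proof -
  have K: "subspace K" "K \<subseteq> V" "dim K = k" using assms(4) by (auto simp: interval_def dim_zero)
  have finF: "finite (F i)" if "i \<le> v" for i using assms(1) F(1)[OF that] by (auto intro: rev_finite_subset)
  let ?g = "\<lambda>j. dim (K \<inter> F j)"
  have step: "?g j \<le> ?g (Suc j)" "?g (Suc j) \<le> Suc (?g j)" if "j < v" for j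
    using flag_dim_Int[OF K(1), of "F j" "F (Suc j)"] F(1)[of j] F(1)[of "Suc j"] F(2)[OF that] finF[of "Suc j"] that
    by auto
  have gle: "?g j \<le> j" if "j \<le> v" for j
    using dim_mono_fin[of "K \<inter> F j" "F j"] F(1)[OF that] finF[OF that] K(1) subspace_inter by auto
  have "F v = V" using dim_eq_imp_eq[of "F v" V] F(1)[of v] assms(1-3) by auto
  then have gv: "?g v = k" using K by (simp add: Int_absorb2)
  have g0: "?g 0 = 0" using gle[of 0] by simp
  show "\<exists>!i. i \<le> v - k \<and> ?g (a + i) = a \<and> ?g (Suc (a + i)) = Suc a" if "a < k"
    using unit_step_crossing[of v ?g a] step g0 gv that by simp
  show "\<exists>!i. i \<le> k \<and> ?g (a + i) = i \<and> ?g (Suc (a + i)) = i" if a: "a < v - k"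
  proof -
    \<comment> \<open>\<open>?h\<close> counts the flag steps at which the intersection with
      \<open>K\<close> does not grow. It again has unit steps and ends at \<open>v - k\<close>, so
      its crossings have offsets up to \<open>v - (v - k) = k\<close>.\<close>
    let ?h = "\<lambda>j. j - ?g j"
    have kv: "k \<le> v" using gle[of v] gv by simp
    have "\<exists>!i. i \<le> v - ?h v \<and> ?h (a + i) = a \<and> ?h (Suc (a + i)) = Suc a"
    proof (rule unit_step_crossing)
      fix j assume "j < v"
      then show "?h j \<le> ?h (Suc j) \<and> ?h (Suc j) \<le> Suc (?h j)" using step[of j] gle[of j] by auto
    qed (use a gv in auto)
    moreover have "v - ?h v = k" using gv kv by simp
    moreover have "?h (a + i) = a \<and> ?h (Suc (a + i)) = Suc a \<longleftrightarrow> ?g (a + i) = i \<and> ?g (Suc (a + i)) = i"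
      if "i \<le> k" for i
    proof -
      have "Suc (a + i) \<le> v" using that a by linarith
      then show ?thesis using gle[of "a + i"] gle[of "Suc (a + i)"] by auto
    qed
    ultimately show ?thesis by (metis (no_types, lifting))
  qed
qed

text \<open>Blocks are sorted by the flag step at which the intersection dimension passes from
  \<open>a\<close> to \<open>Suc a\<close>. Below the step lie \<open>a\<close>-dimensional
  subspaces of \<open>F (a + i)\<close>, above it rank \<open>k\<close> subspaces over
  \<open>F (Suc (a + i))\<close>; the step itself accounts for the remaining dimension of the
  block.\<close>

lemma LS_cover:
  assumes V: "subspace V" "finite V" "dim V = Suc a + k + b"
    and LS: "\<And>i. i \<le> b \<Longrightarrow> \<exists>s1 s2. s1 + s2 = s \<and> LS N a i s1 \<and> LS N k (b - i) s2"
  shows "LS N (Suc a + k) b s"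
proof -
  obtain F where F: "\<And>i. i \<le> dim V \<Longrightarrow> subspace (F i) \<and> F i \<subseteq> V \<and> dim (F i) = i"
    "\<And>i. i < dim V \<Longrightarrow> F i \<subseteq> F (Suc i)" using full_flag[OF V(1,2)] by blast
  have finF: "finite (F i)" if "i \<le> dim V" for i using V(2) F(1)[OF that] by (auto intro: rev_finite_subset)
  show ?thesis
  proof (rule LS_decomposition[where V = V and n = b and U = "\<lambda>i. F (a + i)" and X = "\<lambda>i. F (a + i)" and W = "\<lambda>i. F (Suc (a + i))"
        and a = "\<lambda>_. a" and c = "\<lambda>i. i" and d = "\<lambda>_. k" and e = "\<lambda>i. b - i", OF V])
    fix i assume i: "i \<le> b"
    then have le: "a + i \<le> dim V" "Suc (a + i) \<le> dim V" "a + i < dim V" using V(3) by auto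
    show "subspace (F (a + i)) \<and> subspace (F (a + i)) \<and> subspace (F (Suc (a + i))) \<and>
        F (a + i) \<subseteq> F (a + i) \<and> F (a + i) \<subseteq> F (Suc (a + i)) \<and> F (Suc (a + i)) \<subseteq> V"
      using F(1)[OF le(1)] F(1)[OF le(2)] F(2)[OF le(3)] by blast
    show "dim (F (a + i)) = a + i \<and> dim V = dim (F (Suc (a + i))) + k + (b - i) \<and>
        Suc a + k + dim (F (a + i)) = a + dim (F (Suc (a + i))) + k"
      using F(1)[OF le(1)] F(1)[OF le(2)] V(3) i by simp
    show "\<exists>s1 s2. s1 + s2 = s \<and> LS N a i s1 \<and> LS N k (b - i) s2" by (rule LS[OF i])
  next
    fix K assume KI: "K \<in> interval {0} V (Suc a + k)"
    then have K: "subspace K" "K \<subseteq> V" "dim K = Suc a + k" by (auto simp: interval_def dim_zero)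
    have fK: "finite K" using V(2) K(2) by (rule rev_finite_subset)
    have "\<exists>!i. i \<le> dim V - (Suc a + k) \<and> dim (K \<inter> F (a + i)) = a \<and> dim (K \<inter> F (Suc (a + i))) = Suc a"
      using flag_crossing(1)[OF V(2,1) refl KI F, of a] by simp
    moreover have "dim V - (Suc a + k) = b" using V(3) by simp
    moreover have "K \<inter> F (a + i) \<in> interval {0} (F (a + i)) a \<and> K + F (a + i) \<in> interval (F (Suc (a + i))) V k
        \<longleftrightarrow> dim (K \<inter> F (a + i)) = a \<and> dim (K \<inter> F (Suc (a + i))) = Suc a" if i: "i \<le> b" for i
    proof -
      have le: "a + i \<le> dim V" "Suc (a + i) \<le> dim V" "a + i < dim V" using V(3) i by auto
      note Fa = F(1)[OF le(1)] F(1)[OF le(2)] F(2)[OF le(3)]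
      have "dim (K + F (a + i)) + dim (K \<inter> F (a + i)) = dim K + dim (F (a + i))"
        by (rule dim_sums_Int_fin) (use Fa K fK finF le in auto)
      moreover have "F (Suc (a + i)) \<subseteq> K + F (a + i) \<longleftrightarrow> dim (K \<inter> F (Suc (a + i))) = Suc (dim (K \<inter> F (a + i)))"
        by (rule subset_sum_iff) (use Fa K fK finF le in auto)
      moreover have "subspace (K \<inter> F (a + i))" "subspace (K + F (a + i))" "K + F (a + i) \<subseteq> V"
        using Fa K V(1) by (simp_all add: subspace_inter subspace_set_plus sums_least)
      moreover have "0 \<in> K" "0 \<in> F (a + i)" using K Fa subspace_0 by auto
      ultimately show ?thesis using Fa K by (auto simp: interval_def dim_zero)
    qed
    ultimately show "\<exists>!i. i \<le> b \<and> K \<inter> F (a + i) \<in> interval {0} (F (a + i)) a \<and>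
        K + F (a + i) \<in> interval (F (Suc (a + i))) V k"
      by (metis (no_types, lifting))
  qed
qed

text \<open>The dual sorting, by the step at which the codimension of the intersection in the flag
  member passes from \<open>a\<close> to \<open>Suc a\<close>. That step contributes nothing to the
  block, so the dimension \<open>k\<close> splits as \<open>i\<close> below and \<open>k - i\<close>
  above.\<close>

lemma LS_avoid:
  assumes V: "subspace V" "finite V" "dim V = k + (Suc a + b)"
    and LS: "\<And>i. i \<le> k \<Longrightarrow> \<exists>s1 s2. s1 + s2 = s \<and> LS N i a s1 \<and> LS N (k - i) b s2"
  shows "LS N k (Suc a + b) s"
proof -
  obtain F where F: "\<And>i. i \<le> dim V \<Longrightarrow> subspace (F i) \<and> F i \<subseteq> V \<and> dim (F i) = i"
    "\<And>i. i < dim V \<Longrightarrow> F i \<subseteq> F (Suc i)" using full_flag[OF V(1,2)] by blast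
  have finF: "finite (F i)" if "i \<le> dim V" for i using V(2) F(1)[OF that] by (auto intro: rev_finite_subset)
  show ?thesis
  proof (rule LS_decomposition[where V = V and n = k and U = "\<lambda>i. F (a + i)" and X = "\<lambda>i. F (Suc (a + i))" and W = "\<lambda>i. F (Suc (a + i))"
        and a = "\<lambda>i. i" and c = "\<lambda>_. a" and d = "\<lambda>i. k - i" and e = "\<lambda>_. b", OF V])
    fix i assume i: "i \<le> k"
    then have le: "a + i \<le> dim V" "Suc (a + i) \<le> dim V" "a + i < dim V" using V(3) by auto
    show "subspace (F (a + i)) \<and> subspace (F (Suc (a + i))) \<and> subspace (F (Suc (a + i))) \<and>
        F (a + i) \<subseteq> F (Suc (a + i)) \<and> F (Suc (a + i)) \<subseteq> F (Suc (a + i)) \<and> F (Suc (a + i)) \<subseteq> V"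
      using F(1)[OF le(1)] F(1)[OF le(2)] F(2)[OF le(3)] by blast
    show "dim (F (a + i)) = i + a \<and> dim V = dim (F (Suc (a + i))) + (k - i) + b \<and>
        k + dim (F (Suc (a + i))) = i + dim (F (Suc (a + i))) + (k - i)"
      using F(1)[OF le(1)] F(1)[OF le(2)] V(3) i by simp
    show "\<exists>s1 s2. s1 + s2 = s \<and> LS N i a s1 \<and> LS N (k - i) b s2" by (rule LS[OF i])
  next
    fix K assume KI: "K \<in> interval {0} V k"
    then have K: "subspace K" "K \<subseteq> V" "dim K = k" by (auto simp: interval_def dim_zero)
    have fK: "finite K" using V(2) K(2) by (rule rev_finite_subset)
    have "\<exists>!i. i \<le> k \<and> dim (K \<inter> F (a + i)) = i \<and> dim (K \<inter> F (Suc (a + i))) = i"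
      using flag_crossing(2)[OF V(2,1) refl KI F, of a] V(3) by simp
    moreover have "K \<inter> F (Suc (a + i)) \<in> interval {0} (F (a + i)) i \<and>
          K + F (Suc (a + i)) \<in> interval (F (Suc (a + i))) V (k - i)
        \<longleftrightarrow> dim (K \<inter> F (a + i)) = i \<and> dim (K \<inter> F (Suc (a + i))) = i" if i: "i \<le> k" for i
    proof -
      have le: "a + i \<le> dim V" "Suc (a + i) \<le> dim V" "a + i < dim V" using V(3) i by auto
      note Fa = F(1)[OF le(1)] F(1)[OF le(2)] F(2)[OF le(3)]
      let ?U = "F (a + i)" and ?W = "F (Suc (a + i))"
      have d: "dim (K + ?W) + dim (K \<inter> ?W) = dim K + dim ?W"
        by (rule dim_sums_Int_fin) (use Fa K fK finF le in auto)
      have s: "subspace (K \<inter> ?U)" "subspace (K \<inter> ?W)" "subspace (K + ?W)" "K + ?W \<subseteq> V" "?W \<subseteq> K + ?W"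
        using Fa K V(1) by (simp_all add: subspace_inter subspace_set_plus sums_least sums_upper2)
      have z: "0 \<in> K" "0 \<in> ?W" using K Fa subspace_0 by auto
      have fi: "finite (K \<inter> ?W)" using fK by simp
      have le': "K \<inter> ?U \<subseteq> K \<inter> ?W" using Fa by blast
      show ?thesis
      proof
        assume h: "K \<inter> ?W \<in> interval {0} ?U i \<and> K + ?W \<in> interval ?W V (k - i)"
        then have "K \<inter> ?W = K \<inter> ?U" using le' by (auto simp: interval_def)
        then show "dim (K \<inter> ?U) = i \<and> dim (K \<inter> ?W) = i" using h by (auto simp: interval_def dim_zero)
      next
        assume h: "dim (K \<inter> ?U) = i \<and> dim (K \<inter> ?W) = i"
        then have "K \<inter> ?U = K \<inter> ?W" using dim_eq_imp_eq[OF s(1,2) fi le'] by simp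
        then have "K \<inter> ?W \<subseteq> ?U" by blast
        then show "K \<inter> ?W \<in> interval {0} ?U i \<and> K + ?W \<in> interval ?W V (k - i)"
          using h s z d K i by (auto simp: interval_def dim_zero)
      qed
    qed
    ultimately show "\<exists>!i. i \<le> k \<and> K \<inter> F (Suc (a + i)) \<in> interval {0} (F (a + i)) i \<and>
        K + F (Suc (a + i)) \<in> interval (F (Suc (a + i))) V (k - i)"
      by (metis (no_types, lifting))
  qed
qed

section \<open>The two inductions on the parameters\<close>

lemma space_of_dim_exists:
  assumes "infinite (UNIV :: 'b set)"
  shows "\<exists>V. subspace V \<and> finite V \<and> dim V = n"
proof (induction n)
  case 0
  then show ?case using subspace_single_0 dim_zero by blast
next
  case (Suc n)
  then obtain V where V: "subspace V" "finite V" "dim V = n" by blast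
  then obtain x where "x \<notin> V" using assms ex_new_if_finite by blast
  then have "finite (span (insert x V)) \<and> dim (span (insert x V)) = Suc n"
    using adjoin[of V x] V by simp
  then show ?case using subspace_span by blast
qed

text \<open>The first induction raises the codimension by 4 through \<open>LS_avoid\<close>, the
  second raises the block dimension by 4 through \<open>LS_cover\<close>, both with
  \<open>a = 3\<close>. The last argument 3 is the shifted form of strength 2.\<close>

lemma LS_3_residues:
  assumes inf: "infinite (UNIV :: 'b set)" and base: "LS N 3 3 3"
  shows "LS N (4 * l + 3) (4 * n + 3) 3"
proof -
  have 3: "LS N 3 (4 * n + 3) 3" for n
  proof (induction n)
    case 0 then show ?case using base by simp
  next
    case (Suc n)
    obtain V where V: "subspace V" "finite V" "dim V = 3 + (Suc 3 + (4 * n + 3))"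
      using space_of_dim_exists[OF inf] by blast
    have "LS N 3 (Suc 3 + (4 * n + 3)) 3"
    proof (rule LS_avoid[OF V])
      fix i :: nat assume i: "i \<le> 3"
      \<comment> \<open>Deriving the base \<open>3 - i\<close> times and the induction hypothesis
        \<open>i\<close> times leaves shifted strengths \<open>i\<close> and \<open>3 - i\<close>,
        whose sum is 3.\<close>
      have "LS N i 3 i" using LS_derived_iter[OF base, of "3 - i"] i by simp
      moreover have "LS N (3 - i) (4 * n + 3) (3 - i)" using LS_derived_iter[OF Suc, of i] i by simp
      ultimately show "\<exists>s1 s2. s1 + s2 = 3 \<and> LS N i 3 s1 \<and> LS N (3 - i) (4 * n + 3) s2"
        using i by (intro exI[of _ i] exI[of _ "3 - i"]) simp
    qed
    then show ?case by (simp add: algebra_simps)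
  qed
  show ?thesis
  proof (induction l arbitrary: n)
    case 0 then show ?case using 3 by simp
  next
    case (Suc l)
    obtain V where V: "subspace V" "finite V" "dim V = Suc 3 + (4 * l + 3) + (4 * n + 3)"
      using space_of_dim_exists[OF inf] by blast
    have "LS N (Suc 3 + (4 * l + 3)) (4 * n + 3) 3"
    proof (rule LS_cover[OF V])
      fix i :: nat assume i: "i \<le> 4 * n + 3"
      \<comment> \<open>With \<open>i = 4 * j + r\<close>, the lower part is a residual of
        codimension \<open>4 * j + 3\<close> taken \<open>3 - r\<close> times, and the upper part
        one of codimension \<open>4 * (n - j) + 3\<close> taken \<open>r\<close> times. The shifted
        strengths left are \<open>r\<close> and \<open>3 - r\<close>. The induction hypothesis is
        needed at \<open>n - j\<close>, hence the generalisation over \<open>n\<close>.\<close>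
      define j r where "j = i div 4" and "r = i mod 4"
      have jr: "i = 4 * j + r" "r \<le> 3" by (auto simp: j_def r_def)
      have "j \<le> n" using i jr by linarith
      have "LS N 3 (4 * j + 3 - (3 - r)) (3 - (3 - r))" by (rule LS_residual_iter[OF 3]) auto
      then have "LS N 3 i r" using jr by (simp add: algebra_simps)
      moreover have "LS N (4 * l + 3) (4 * (n - j) + 3 - r) (3 - r)"
        by (rule LS_residual_iter[OF Suc]) (use jr in auto)
      then have "LS N (4 * l + 3) (4 * n + 3 - i) (3 - r)"
        using jr \<open>j \<le> n\<close> by (simp add: algebra_simps)
      ultimately show "\<exists>s1 s2. s1 + s2 = 3 \<and> LS N 3 i s1 \<and> LS N (4 * l + 3) (4 * n + 3 - i) s2"
        using jr by (intro exI[of _ r] exI[of _ "3 - r"]) simp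
    qed
    then show ?case by (simp add: algebra_simps)
  qed
qed

subsection \<open>Large sets\<close>

lemma subspaces_of_dim_eq_interval:
  assumes "finite V"
  shows "subspaces_of_dim V k = interval {0} V k"
  using assms subspace_0 finite_subset
  by (auto simp: subspaces_of_dim_def interval_def space_of_dim_def dim_zero)

text \<open>The \<open>N\<close> parts are numbered and each block gets the number of its part as
  colour.\<close>

lemma large_set_imp_LS:
  assumes P: "large_set N t k v V P" and t: "t \<le> k" "k \<le> v"
  shows "LS N k (v - k) (Suc t)"
proof -
  have sd: "space_of_dim V v" and fP: "finite P" "card P = N"
    and part': "partition_on (subspaces_of_dim V k) P"
    using P unfolding large_set_def by blast+
  have V: "subspace V" "finite V" "dim V = v" using sd by (simp_all add: space_of_dim_def)
  have part: "partition_on (interval {0} V k) P"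
    using part' by (simp add: subspaces_of_dim_eq_interval[OF V(2)])
  obtain l where "\<forall>\<B>\<in>P. subspace_design t v k l V \<B>" using P unfolding large_set_def by blast
  then have l: "card {K\<in>\<B>. T \<subseteq> K} = l" if "\<B> \<in> P" "T \<in> interval {0} V t" for \<B> T
    using that by (simp add: subspace_design_def subspaces_of_dim_eq_interval[OF V(2)])
  obtain e where e: "bij_betw e P {0..<N}" using ex_bij_betw_finite_nat[OF fP(1)] fP(2) by blast
  define part_of where "part_of K = (THE \<B>. \<B> \<in> P \<and> K \<in> \<B>)" for K
  have part_of: "part_of K = \<B>" if "\<B> \<in> P" "K \<in> \<B>" for \<B> K
    unfolding part_of_def
  proof (rule the_equality)
    show "\<B> \<in> P \<and> K \<in> \<B>" using that by simp
    show "\<C> = \<B>" if "\<C> \<in> P \<and> K \<in> \<C>" for \<C>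
      using that \<open>\<B> \<in> P\<close> \<open>K \<in> \<B>\<close> disjointD[OF partition_onD2[OF part], of \<C> \<B>] by blast
  qed
  have cov: "\<exists>\<B>\<in>P. K \<in> \<B>" if "K \<in> interval {0} V k" for K
    using partition_onD1[OF part] that by blast
  have "balanced N (Suc t) {0} V (interval {0} V k) (\<lambda>K. e (part_of K))"
  proof (rule balanced_downward[OF V(1,2) t(1)])
    show "\<forall>K\<in>interval {0} V k. e (part_of K) < N"
    proof
      fix K assume "K \<in> interval {0} V k"
      then obtain \<B> where "\<B> \<in> P" "K \<in> \<B>" using cov by blast
      then have "e (part_of K) \<in> {0..<N}" using part_of e by (auto simp: bij_betw_def)
      then show "e (part_of K) < N" by simp
    qed
    fix T assume T: "T \<in> interval {0} V t"
    have "card {K \<in> interval {0} V k. T \<subseteq> K \<and> e (part_of K) = i} = l" if "i < N" for i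
    proof -
      have "i \<in> e ` P" using e that by (auto simp: bij_betw_def)
      then obtain \<B> where \<B>: "\<B> \<in> P" "e \<B> = i" by blast
      have "{K \<in> interval {0} V k. T \<subseteq> K \<and> e (part_of K) = i} = {K\<in>\<B>. T \<subseteq> K}"
      proof (intro equalityI subsetI)
        fix K assume K: "K \<in> {K \<in> interval {0} V k. T \<subseteq> K \<and> e (part_of K) = i}"
        then obtain \<C> where C: "\<C> \<in> P" "K \<in> \<C>" using cov by blast
        then have "e \<C> = e \<B>" using K part_of \<B> by simp
        then have "\<C> = \<B>" using C(1) \<B>(1) e by (auto simp: bij_betw_def inj_on_def)
        then show "K \<in> {K\<in>\<B>. T \<subseteq> K}" using C K by simp
      next
        fix K assume K: "K \<in> {K\<in>\<B>. T \<subseteq> K}"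
        then have "K \<in> interval {0} V k" using \<B>(1) partition_onD1[OF part] by blast
        then show "K \<in> {K \<in> interval {0} V k. T \<subseteq> K \<and> e (part_of K) = i}"
          using K \<B> part_of by simp
      qed
      then show ?thesis using l[OF \<B>(1) T] by simp
    qed
    then show "\<exists>l. \<forall>i<N. card {K \<in> interval {0} V k. T \<subseteq> K \<and> e (part_of K) = i} = l" by blast
  qed (use t V in simp)
  moreover have "{0} \<subseteq> V" using V(1) subspace_0 by blast
  moreover have "dim V = dim {0} + k + (v - k)" using V(3) t(2) dim_zero by simp
  ultimately show ?thesis
    using V(1,2) subspace_single_0 unfolding LS_def partitionable_def by blast
qed

text \<open>\<open>balanced\<close> lets the common count depend on \<open>T\<close>, while a large
  set has one \<lambda> for all \<open>T\<close>. This count is what makes the two agree.\<close>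

lemma card_interval_above:
  assumes V: "subspace V" "finite V" and T: "T \<in> interval {0} V t" "T' \<in> interval {0} V t"
  shows "card {K \<in> interval {0} V k. T \<subseteq> K} = card {K \<in> interval {0} V k. T' \<subseteq> K}"
proof (cases "t \<le> k")
  case True
  have above: "{K \<in> interval {0} V k. S \<subseteq> K} = interval S V (k - t)" if "S \<in> interval {0} V t" for S
    using that True subspace_0 by (auto simp: interval_def dim_zero)
  have sub: "subspace T" "T \<subseteq> V" "subspace T'" "T' \<subseteq> V" and "dim T = dim T'"
    using T by (auto simp: interval_def)
  then have "dim V + dim T' = dim V + dim T" by simp
  then obtain F G where FG: "F ` interval T V (k - t) \<subseteq> interval T' V (k - t)"
      "G ` interval T' V (k - t) \<subseteq> interval T V (k - t)"
      "\<And>K. K \<in> interval T V (k - t) \<Longrightarrow> G (F K) = K" "\<And>K. K \<in> interval T' V (k - t) \<Longrightarrow> F (G K) = K"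
    using interval_isomorphism[OF sub(1) V sub(2,3) V sub(4)] by metis
  then have "bij_betw F (interval T V (k - t)) (interval T' V (k - t))"
    by (intro bij_betw_byWitness[where f' = G]) auto
  then show ?thesis unfolding above[OF T(1)] above[OF T(2)] by (rule bij_betw_same_card)
next
  case False
  have none: "{K \<in> interval {0} V k. S \<subseteq> K} = {}" if S: "S \<in> interval {0} V t" for S
  proof -
    have "\<not> S \<subseteq> K" if "K \<in> interval {0} V k" for K
    proof
      assume "S \<subseteq> K"
      then have "dim S \<le> dim K"
        using S that V(2) by (intro dim_mono_fin) (auto simp: interval_def intro: rev_finite_subset)
      then show False using False S that by (simp add: interval_def dim_zero)
    qed
    then show ?thesis by blast
  qed
  show ?thesis by (simp only: none[OF T(1)] none[OF T(2)])
qed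

text \<open>The colour classes are the parts. The number of blocks of one colour through
  \<open>T\<close> is the number of all blocks through \<open>T\<close> divided by \<open>N\<close>,
  which depends only on the dimension of \<open>T\<close>.\<close>

lemma LS_imp_large_set:
  assumes LS: "LS N k b (Suc t)" and V: "space_of_dim V (k + b)"
  shows "\<exists>P. large_set N t k (k + b) V P"
proof -
  have V': "subspace V" "finite V" "dim V = k + b" "{0} \<subseteq> V"
    using V subspace_0 by (auto simp: space_of_dim_def)
  let ?I = "interval {0} V k"
  have fI: "finite ?I" by (rule finite_interval[OF V'(2)])
  obtain f where f: "balanced N (Suc t) {0} V ?I f"
    using LS_imp_partitionable[OF LS subspace_single_0 V'(1,2,4)] V'(3) dim_zero
    unfolding partitionable_def by auto
  have lt: "f K < N" if "K \<in> ?I" for K using f that by (simp add: balanced_def)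
  have sum: "(\<Sum>i<N. card {K\<in>?I. T \<subseteq> K \<and> f K = i}) = card {K\<in>?I. T \<subseteq> K}" for T
  proof -
    have "{K\<in>?I. T \<subseteq> K} = (\<Union>i<N. {K\<in>?I. T \<subseteq> K \<and> f K = i})" using lt by auto
    also have "card \<dots> = (\<Sum>i<N. card {K\<in>?I. T \<subseteq> K \<and> f K = i})"
      using fI by (intro card_UN_disjoint) auto
    finally show ?thesis by simp
  qed
  have cnt: "card {K\<in>?I. T \<subseteq> K \<and> f K = i} = card {K\<in>?I. T \<subseteq> K} div N"
    if T: "T \<in> interval {0} V u" "u \<le> t" and i: "i < N" for T u i
  proof -
    have "subspace T \<and> {0} \<subseteq> T \<and> T \<subseteq> V \<and> dim T < dim {0} + Suc t"
      using T by (simp add: interval_def dim_zero)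
    then obtain l where l: "\<forall>i<N. card {K\<in>?I. T \<subseteq> K \<and> f K = i} = l"
      using f unfolding balanced_def by blast
    then have "card {K\<in>?I. T \<subseteq> K} = N * l" using sum[of T] by simp
    then show ?thesis using l i by simp
  qed
  define \<B> where "\<B> i = {K\<in>?I. f K = i}" for i
  \<comment> \<open>The test space \<open>{0}\<close> shows that all colour classes have the same
    size. One of them contains \<open>M\<close>, so none is empty, and there are exactly
    \<open>N\<close> distinct parts.\<close>
  have sub0: "{0} \<in> interval {0} V 0" using V' subspace_single_0 by (simp add: interval_def)
  have size: "{K\<in>?I. {0} \<subseteq> K \<and> f K = i} = \<B> i" "{K\<in>?I. {0} \<subseteq> K} = ?I" for i
    by (auto simp: \<B>_def interval_def)
  obtain M where "subspace M" "{0} \<subseteq> M" "M \<subseteq> V" "dim M = k"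
    using intermediate_subspace[OF subspace_single_0 V'(1,2,4), of k] V'(3) dim_zero by auto
  then have "M \<in> ?I" by (simp add: interval_def dim_zero)
  then have nonempty: "\<B> i \<noteq> {}" if i: "i < N" for i
  proof -
    have "card (\<B> j) = card ?I div N" if "j < N" for j
      using cnt[OF sub0 le0 that] size by simp
    moreover have "\<B> (f M) \<noteq> {}" "f M < N" using \<open>M \<in> ?I\<close> lt by (auto simp: \<B>_def)
    moreover have "finite (\<B> j)" for j using fI by (simp add: \<B>_def)
    ultimately show ?thesis using i by (metis card_eq_0_iff)
  qed
  define P where "P = \<B> ` {..<N}"
  have inj: "inj_on \<B> {..<N}"
  proof (rule inj_onI)
    fix i j assume h: "i \<in> {..<N}" "j \<in> {..<N}" "\<B> i = \<B> j"
    then obtain K where "K \<in> \<B> i" using nonempty by blast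
    then show "i = j" using h by (auto simp: \<B>_def)
  qed
  have "large_set N t k (k + b) V P"
    unfolding large_set_def
  proof (intro conjI)
    show "space_of_dim V (k + b)" by (rule V)
    show "finite P" by (simp add: P_def)
    show "card P = N" using inj by (simp add: P_def card_image)
    show "partition_on (subspaces_of_dim V k) P"
      unfolding subspaces_of_dim_eq_interval[OF V'(2)]
    proof (rule partition_onI)
      show "\<Union>P = ?I" using lt by (auto simp: P_def \<B>_def)
      show "{} \<notin> P" using nonempty by (auto simp: P_def)
      show "disjnt p p'" if "p \<in> P" "p' \<in> P" "p \<noteq> p'" for p p'
        using that by (auto simp: P_def \<B>_def disjnt_def)
    qed
    have des: "card {K\<in>\<B> i. T \<subseteq> K} = card {K\<in>?I. T' \<subseteq> K} div N"
      if "T \<in> interval {0} V t" "T' \<in> interval {0} V t" "i < N" for T T' i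
    proof -
      have "{K\<in>\<B> i. T \<subseteq> K} = {K\<in>?I. T \<subseteq> K \<and> f K = i}" by (auto simp: \<B>_def)
      then show ?thesis
        using cnt[OF that(1) le_refl that(3)] card_interval_above[OF V'(1,2) that(1,2)] by simp
    qed
    \<comment> \<open>Any \<open>t\<close>-dimensional subspace gives the right value; if there is
      none, the design condition is vacuous.\<close>
    define l where "l = card {K\<in>?I. (SOME T. T \<in> interval {0} V t) \<subseteq> K} div N"
    have "card {K\<in>\<B> i. T \<subseteq> K} = l" if "T \<in> interval {0} V t" "i < N" for T i
      unfolding l_def by (rule des[OF that(1) someI[of "\<lambda>T. T \<in> interval {0} V t" T, OF that(1)] that(2)])
    then show "\<exists>l. \<forall>\<B>\<in>P. subspace_design t (k + b) k l V \<B>"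
      unfolding subspace_design_def subspaces_of_dim_eq_interval[OF V'(2)]
      using V by (intro exI[of _ l]) (auto simp: P_def \<B>_def)
  qed
  then show ?thesis by blast
qed

end

lemma infinite_UNIV_fun: "infinite (UNIV :: (nat \<Rightarrow> 'a::{field,finite}) set)"
proof
  assume "finite (UNIV :: (nat \<Rightarrow> 'a) set)"
  moreover have "card (UNIV :: 'a set) \<noteq> Suc 0"
    using fun_space.q_gt_1[where ?'a = 'a] by simp
  ultimately have "finite (UNIV :: nat set)" by (rule finite_fun_UNIVD1)
  then show False by simp
qed

theorem theorem6p4:
  fixes q N :: nat
  assumes "primepow q"
    and "CARD('a::{field,finite}) = q"
    and "N > 0"
    and "LS_exists TYPE('a) N 2 3 6"
  shows "\<forall>v k :: nat. v \<ge> 6 \<and> [v = 2] (mod 4) \<and> 3 \<le> k \<and> k \<le> v - 3 \<and> [k = 3] (mod 4)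
           \<longrightarrow> LS_exists TYPE('a) N 2 k v"
proof (intro allI impI)
  fix v k :: nat
  assume h: "v \<ge> 6 \<and> [v = 2] (mod 4) \<and> 3 \<le> k \<and> k \<le> v - 3 \<and> [k = 3] (mod 4)"
  then have m: "v mod 4 = 2" "k mod 4 = 3" by (simp_all add: cong_def)
  have "k \<le> v" using h by linarith
  define l n where "l = k div 4" and "n = (v - k) div 4"
  have k: "k = 4 * l + 3" using m by (simp add: l_def) presburger
  \<comment> \<open>From the residues 2 and 3 of \<open>v\<close> and \<open>k\<close>, the
    codimension \<open>v - k\<close> is again 3 modulo 4.\<close>
  have vk: "v - k = 4 * n + 3" using m \<open>k \<le> v\<close> unfolding n_def by presburger
  have v: "v = k + (4 * n + 3)" using h vk by linarith
  obtain V0 :: "(nat \<Rightarrow> 'a) set" and P0 where "fun_space.large_set N 2 3 6 V0 P0"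
    using assms(4) unfolding LS_exists_def by blast
  then have "fun_space.LS TYPE('a) N 3 (6 - 3) (Suc 2)" by (rule fun_space.large_set_imp_LS) simp_all
  then have "fun_space.LS TYPE('a) N 3 3 3" by (simp add: numeral_3_eq_3)
  then have LS: "fun_space.LS TYPE('a) N k (4 * n + 3) (Suc 2)"
    unfolding k using fun_space.LS_3_residues[OF infinite_UNIV_fun] by simp
  obtain V :: "(nat \<Rightarrow> 'a) set" where "fun_space.space_of_dim V (k + (4 * n + 3))"
    using fun_space.space_of_dim_exists[OF infinite_UNIV_fun] unfolding fun_space.space_of_dim_def by blast
  then obtain P where "fun_space.large_set N 2 k (k + (4 * n + 3)) V P"
    using fun_space.LS_imp_large_set[OF LS] by blast
  then show "LS_exists TYPE('a) N 2 k v" unfolding LS_exists_def v by blast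
qed

end
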